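(* Let $p\in(1,\infty)$, let $\rho\in[2,\infty)$, and let $B$ be a Banach space with martingale cotype $\rho$. Then there exists a constant $C_{p,\rho,B}<\infty$, depending only on $p$, $\rho$ and $B$, such that for every $\sigma$-finite measure space $(X,\mathcal{B},\mathfrak{m})$, every finite totally ordered set $\mathbb{I}$, and every martingale $\mathfrak{f}=(\mathfrak{f}_t)_{t\in\mathbb{I}}:X\to B$ indexed by $\mathbb{I}$ with values in $B$, \[ J^{p}_{\rho}(\mathfrak{f}:X\times\mathbb{I}\to B)\le C_{p,\rho,B}\,\sup_{t\in\mathbb{I}}\|\mathfrak{f}_t\|_{L^p(X;B)} . \]
   Context: $\mathbb{N}=\{0,1,2,\dots\}$. For a totally ordered set $\mathbb{I}$, a function $f:\mathbb{I}\to B$ and $\lambda>0$, the $\lambda$-jump counting function is \[ N_\lambda(f(t):t\in\mathbb{I}):=\sup\{J\in\mathbb{N} : \exists\, t_0<\dots<t_J \text{ in } \mathbb{I} \text{ with } \min_{0<j\le J}\|f(t_j)-f(t_{j-1})\|_B\ge\lambda\}. \] For $f:X\times\mathbb{I}\to B$ and $0<p<\infty$, $0<\rho<\infty$, \[ J^p_\rho(f)=J^p_\rho(f:X\times\mathbb{I}\to B):=\sup_{\lambda>0}\big\|\lambda N_\lambda(f(\cdot,t):t\in\mathbb{I})^{1/\rho}\big\|_{L^p(X)} ; \] for a family $\mathfrak{f}=(\mathfrak{f}_t)_{t\in\mathbb I}$ one sets $f(x,t)=\mathfrak{f}_t(x)$. Martingales: a filtration $(\mathcal{G}_t)_{t\in\mathbb{I}}$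 is an increasing family of sub-$\sigma$-algebras of $\mathcal{B}$ such that $\mathfrak{m}$ is $\sigma$-finite on each $\mathcal{G}_t$. A $B$-valued martingale adapted to it is a family $(\mathfrak{f}_t)_{t\in\mathbb{I}}\subset L^1_{\mathrm{loc}}(X,\mathcal{B},\mathfrak{m};B)$ such that $\mathfrak{f}_{t'}=\mathbb{E}(\mathfrak{f}_t\mid\mathcal{G}_{t'})$ for all $t'\le t$ in $\mathbb{I}$. Martingale cotype: $B$ has martingale cotype $\rho\in[2,\infty)$ if for every $p\in[1,\infty)$ there is a constant $C_p$ such that every $B$-valued martingale $(\mathfrak{f}_n)_{n\in\mathbb{N}}$ satisfies $\|S_\rho\mathfrak{f}\|_{L^p(X)}\le C_p\|\mathfrak{f}_\star\|_{L^p(X)}$, where $S_\rho\mathfrak{f}:=\big(\sum_{n>0}\|\mathfrak{f}_n-\mathfrak{f}_{n-1}\|_B^\rho\big)^{1/\rho}$ and $\mathfrak{f}_\star(x):=\sup_{n\in\mathbb{N}}\|\mathfrak{f}_n(x)\|_B$; the constant $C_p$ does not depend on the martingale (nor on the underlying measure space). *)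

theory Defs
  imports "HOL-Probability.Probability"
begin

section \<open>Extended powers and $L^p$ norms\<close>

text \<open>Only used for exponents \<open>a > 0\<close>.\<close>

definition epowr :: "ennreal \<Rightarrow> real \<Rightarrow> ennreal" where
  "epowr x a = (if x = \<top> then \<top> else ennreal (enn2real x powr a))"

definition Lp_norm :: "real \<Rightarrow> 'a measure \<Rightarrow> ('a \<Rightarrow> ennreal) \<Rightarrow> ennreal" where
  "Lp_norm p M g = epowr (\<integral>\<^sup>+ x. epowr (g x) p \<partial>M) (1 / p)"

section \<open>Functions with values in an arbitrary Banach space\<close>

text \<open>
  The library's Bochner integral requires the target space to be second countable.
  To cover non-separable Banach spaces, strong measurability and the Bochner integral are
  set up here for every Banach space, from the library's integral of simple functions.
\<close>

definition strongly_measurable :: "'a measure \<Rightarrow> ('a \<Rightarrow> 'b::banach) \<Rightarrow> bool" where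
  "strongly_measurable M f \<longleftrightarrow>
     (\<exists>s. (\<forall>i::nat. simple_function M (s i)) \<and>
          (\<forall>x\<in>space M. (\<lambda>i. s i x) \<longlonglongrightarrow> f x))"

text \<open>\<open>has_set_bochner_integral M A f v\<close>: \<open>f\<close> is Bochner integrable over \<open>A\<close> with integral \<open>v\<close>.\<close>

definition has_set_bochner_integral ::
    "'a measure \<Rightarrow> 'a set \<Rightarrow> ('a \<Rightarrow> 'b::banach) \<Rightarrow> 'b \<Rightarrow> bool" where
  "has_set_bochner_integral M A f v \<longleftrightarrow>
     strongly_measurable M (\<lambda>x. indicator A x *\<^sub>R f x) \<and>
     (\<exists>s. (\<forall>i::nat. Bochner_Integration.simple_bochner_integrable M (s i)) \<and>
          (\<lambda>i. \<integral>\<^sup>+ x. ennreal (norm (indicator A x *\<^sub>R f x - s i x)) \<partial>M) \<longlonglongrightarrow> 0 \<and>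
          (\<lambda>i. Bochner_Integration.simple_bochner_integral M (s i)) \<longlonglongrightarrow> v)"

definition L1_loc :: "'a measure \<Rightarrow> ('a \<Rightarrow> 'b::banach) set" where
  "L1_loc M = {f. strongly_measurable M f \<and>
     (\<forall>A\<in>sets M. emeasure M A < \<infinity> \<longrightarrow> (\<integral>\<^sup>+ x\<in>A. ennreal (norm (f x)) \<partial>M) < \<infinity>)}"

text \<open>
  \<open>g = E(f | G)\<close> as an equality almost everywhere: \<open>g\<close> has a \<open>G\<close>-measurable version \<open>h\<close>
  with the same integrals as \<open>f\<close> over all sets of \<open>G\<close> of finite measure.
\<close>

definition is_cond_exp ::
    "'a measure \<Rightarrow> 'a measure \<Rightarrow> ('a \<Rightarrow> 'b::banach) \<Rightarrow> ('a \<Rightarrow> 'b) \<Rightarrow> bool" where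
  "is_cond_exp M G f g \<longleftrightarrow>
     (\<exists>h. strongly_measurable G h \<and> (AE x in M. g x = h x) \<and>
          (\<forall>A\<in>sets G. emeasure M A < \<infinity> \<longrightarrow>
             (\<exists>v. has_set_bochner_integral M A f v \<and> has_set_bochner_integral M A h v)))"

section \<open>Martingales\<close>

text \<open>The totally ordered index set is a subset \<open>I\<close> of a linearly ordered type.\<close>

definition filtration_on ::
    "'a measure \<Rightarrow> 'i::linorder set \<Rightarrow> ('i \<Rightarrow> 'a measure) \<Rightarrow> bool" where
  "filtration_on M I G \<longleftrightarrow>
     (\<forall>t\<in>I. sigma_finite_subalgebra M (G t)) \<and>
     (\<forall>s\<in>I. \<forall>t\<in>I. s \<le> t \<longrightarrow> sets (G s) \<subseteq> sets (G t))"

definition martingale_on ::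
    "'a measure \<Rightarrow> 'i::linorder set \<Rightarrow> ('i \<Rightarrow> 'a measure) \<Rightarrow> ('i \<Rightarrow> 'a \<Rightarrow> 'b::banach) \<Rightarrow> bool" where
  "martingale_on M I G f \<longleftrightarrow>
     filtration_on M I G \<and> (\<forall>t\<in>I. f t \<in> L1_loc M) \<and>
     (\<forall>s\<in>I. \<forall>t\<in>I. s \<le> t \<longrightarrow> is_cond_exp M (G s) (f t) (f s))"

section \<open>Jump functionals\<close>

definition jump_count :: "real \<Rightarrow> 'i::linorder set \<Rightarrow> ('i \<Rightarrow> 'b::banach) \<Rightarrow> enat" where
  "jump_count l I g = Sup {enat J | J. \<exists>t :: nat \<Rightarrow> 'i.
     (\<forall>j\<le>J. t j \<in> I) \<and> (\<forall>j<J. t j < t (Suc j)) \<and>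
     (\<forall>j. 0 < j \<and> j \<le> J \<longrightarrow> l \<le> norm (g (t j) - g (t (j - 1))))}"

definition jump_norm ::
    "real \<Rightarrow> real \<Rightarrow> 'a measure \<Rightarrow> 'i::linorder set \<Rightarrow> ('i \<Rightarrow> 'a \<Rightarrow> 'b::banach) \<Rightarrow> ennreal" where
  "jump_norm p \<rho> M I f = (SUP l\<in>{0<..}. Lp_norm p M
     (\<lambda>x. ennreal l * epowr (ennreal_of_enat (jump_count l I (\<lambda>t. f t x))) (1 / \<rho>)))"

section \<open>Martingale cotype\<close>

definition S_rho :: "real \<Rightarrow> (nat \<Rightarrow> 'a \<Rightarrow> 'b::banach) \<Rightarrow> 'a \<Rightarrow> ennreal" where
  "S_rho \<rho> f x = epowr (\<Sum>n. ennreal (norm (f (Suc n) x - f n x) powr \<rho>)) (1 / \<rho>)"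

definition maximal_fun :: "(nat \<Rightarrow> 'a \<Rightarrow> 'b::banach) \<Rightarrow> 'a \<Rightarrow> ennreal" where
  "maximal_fun f x = (SUP n. ennreal (norm (f n x)))"

text \<open>
  Martingale cotype is a property of the Banach space alone, with constants uniform over all
  measure spaces, whereas a formula of HOL can quantify over the measures on one carrier type
  only.  The carrier \<open>nat \<times> (nat \<Rightarrow> 'b)\<close> loses no generality: for a martingale
  \<open>(f\<^sub>n)\<close> on any measure space \<open>X\<close>, let \<open>k : X \<rightarrow> nat\<close> be measurable for the first
  \<open>\<sigma>\<close>-algebra of the filtration with fibres of finite measure.  The image of the measure under
  \<open>x \<mapsto> (k x, (f\<^sub>n x)\<^sub>n)\<close>, with the filtration generated by \<open>k\<close> and the first
  \<open>n + 1\<close> coordinates, carries a martingale with the same joint distribution.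
\<close>

type_synonym 'b path_space = "nat \<times> (nat \<Rightarrow> 'b)"

definition martingale_cotype :: "'b::banach itself \<Rightarrow> real \<Rightarrow> bool" where
  "martingale_cotype B \<rho> \<longleftrightarrow>
     (\<forall>p\<ge>1. \<exists>C::real. \<forall>(M :: 'b path_space measure) G (f :: nat \<Rightarrow> 'b path_space \<Rightarrow> 'b).
        sigma_finite_measure M \<longrightarrow> martingale_on M UNIV G f \<longrightarrow>
        Lp_norm p M (S_rho \<rho> f) \<le> ennreal C * Lp_norm p M (maximal_fun f))"

section \<open>The constant of the jump inequality\<close>

text \<open>
  An existential quantifier in front of the jump inequality on a carrier type \<open>'a\<close> with an
  index type \<open>'i\<close> would allow the constant to depend on \<open>'a\<close> and \<open>'i\<close>.  So the
  constant is named instead, as a function of \<open>p\<close>, \<open>\<rho>\<close> and the Banach space alone: some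
  constant valid on path space for finite sets of natural numbers as index sets, if there is one.
  By the transfer described above, such a constant is valid for all measure spaces and all finite
  totally ordered index sets.  Nothing is assumed about its existence.
\<close>

definition jump_const :: "real \<Rightarrow> real \<Rightarrow> 'b::banach itself \<Rightarrow> real" where
  "jump_const p \<rho> B =
     (SOME C. \<forall>(M :: 'b path_space measure) (I :: nat set) G (f :: nat \<Rightarrow> 'b path_space \<Rightarrow> 'b).
        sigma_finite_measure M \<longrightarrow> finite I \<longrightarrow> martingale_on M I G f \<longrightarrow>
        jump_norm p \<rho> M I f \<le>
          ennreal C * (SUP t\<in>I. Lp_norm p M (\<lambda>x. ennreal (norm (f t x)))))"

end

theory Submission
  imports Defs
begin

text \<open>
  Fix a threshold \<open>\<lambda>\<close>.  Along every path, choose times greedily: \<open>\<tau>\<^sub>0\<close> is the first index and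
  \<open>\<tau>\<^sub>j\<^sub>+\<^sub>1\<close> is the first time after \<open>\<tau>\<^sub>j\<close> at which the path is at distance at least \<open>\<lambda> / 2\<close> from
  its value at \<open>\<tau>\<^sub>j\<close>.  Of the two ends of a jump of size \<open>\<lambda>\<close>, at least one is at distance
  \<open>\<lambda> / 2\<close> or more from any given point of \<open>B\<close>; so the greedy times make at least \<open>N\<^sub>\<lambda>\<close> jumps of size
  \<open>\<lambda> / 2\<close>, and \<open>\<lambda> N\<^sub>\<lambda> powr (1 / \<rho>)\<close> is at most twice the function
  \<open>S\<^sub>\<rho>\<close> of the sampled sequence \<open>(f\<^bsub>\<tau>\<^sub>j\<^esub>)\<close> (\<open>jump_count_le_S_rho\<close>).  The greedy times are stopping times,
  so by optional stopping the sampled sequence is a martingale (\<open>stopped_martingale\<close>), to which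
  martingale cotype applies at the given exponent \<open>p\<close>.  The resulting maximal function is bounded
  by that of the original martingale, and Doob's inequality (\<open>doob_maximal_inequality\<close>), valid
  because \<open>p > 1\<close>, bounds it by the final value.  The threshold has disappeared from the bound.
  This is \<open>jump_inequality_if_cotype\<close>.

  Cotype concerns measures on the path space only, so this argument gives the inequality there,
  and with it the defining property of \<open>jump_const\<close>.  For a martingale on an arbitrary measure
  space, \<open>path_space_martingale\<close> pushes measure and filtration forward along
  \<open>x \<mapsto> (k x, (f\<^sub>i x)\<^sub>i)\<close>, where \<open>k\<close> is measurable for the first \<open>\<sigma>\<close>-algebra with fibres of finite
  measure; neither the jump functional nor the norms change.

  The target is an arbitrary Banach space.  Its strongly measurable functions are handled
  through one device: a sequence of Borel simple maps \<open>q\<^sub>n\<close> of \<open>B\<close> to itself that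
  converges to the identity on a separable set (\<open>quantizer\<close>).  Composition with them approximates
  a function by simple functions that depend on its value alone, which is what makes
  integrals survive an image of the measure.
\<close>

section \<open>Strong measurability through quantizers\<close>

text \<open>
  The bound \<open>norm (y - q n y) \<le> norm y\<close> forces \<open>q n 0 = 0\<close> and \<open>norm (q n y) \<le> 2 * norm y\<close>;
  so composing an integrable function with \<open>q n\<close> gives integrable simple functions, dominated
  by twice its norm.
\<close>

definition quantizer :: "(nat \<Rightarrow> 'b::real_normed_vector \<Rightarrow> 'b) \<Rightarrow> 'b set \<Rightarrow> bool" where
  "quantizer q D \<longleftrightarrow> (\<forall>n. simple_function borel (q n)) \<and> (\<forall>n y. norm (y - q n y) \<le> norm y) \<and>
     (\<forall>y\<in>closure D. (\<lambda>n. q n y) \<longlonglongrightarrow> y)"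

text \<open>
  Send \<open>y\<close> to the best approximation among \<open>0\<close> and the first \<open>n\<close> points of a dense sequence.
  Taking part from the start, the point \<open>0\<close> gives the norm bound.
\<close>

lemma quantizer_exists:
  fixes D :: "'b::real_normed_vector set"
  assumes "countable D"
  obtains q where "quantizer q D"
proof -
  define d where "d = from_nat_into (insert 0 D)"
  have "range d = insert 0 D"
    unfolding d_def using assms by (intro range_from_nat_into) auto
  then obtain z where z: "d z = 0" by (metis imageE insertI1)
  \<comment> \<open>\<open>r n y\<close> is the index of the best candidate so far; a later one wins only if strictly closer.\<close>
  define r where "r = rec_nat (\<lambda>_. z) (\<lambda>n r y. if dist y (d n) < dist y (d (r y)) then n else r y)"
  have r0: "r 0 = (\<lambda>_. z)"
    and rS: "r (Suc n) = (\<lambda>y. if dist y (d n) < dist y (d (r n y)) then n else r n y)" for n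
    by (simp_all add: r_def cong: if_cong)
  define q where "q n y = d (r n y)" for n y
  have r_range: "r n y \<in> insert z {..<n}" for n y
    by (induction n) (auto simp: r0 rS less_Suc_eq)
  have r_meas: "r n \<in> measurable borel (count_space UNIV)" for n
  proof (induction n)
    case 0
    then show ?case by (simp add: r0)
  next
    case (Suc n)
    note [measurable] = Suc
    have dist: "(\<lambda>y. dist y (d (r n y))) \<in> borel_measurable borel"
      by (rule measurable_compose_countable[of "\<lambda>i y. dist y (d i)"])
        (auto intro!: borel_measurable_continuous_onI continuous_intros)
    have [measurable]: "Measurable.pred borel (\<lambda>y. dist y (d n) < dist y (d (r n y)))"
      by (intro borel_measurable_pred_less dist) (auto intro!: borel_measurable_continuous_onI continuous_intros)
    show ?case unfolding rS by measurable
  qed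
  have simple: "simple_function borel (q n)" for n
  proof -
    have "simple_function borel (r n)"
      unfolding simple_function_def
    proof safe
      show "finite (r n ` space borel)"
        by (rule finite_subset[of _ "insert z {..<n}"]) (use r_range in auto)
      show "r n -` {r n y} \<inter> space borel \<in> sets borel" for y
        by (rule measurable_sets[OF r_meas]) simp
    qed
    then show ?thesis unfolding q_def by (rule simple_function_compose1)
  qed
  have dec: "dist y (q (Suc n) y) \<le> dist y (q n y)" for n y
    by (auto simp: q_def rS)
  then have anti: "dist y (q m y) \<le> dist y (q n y)" if "n \<le> m" for n m y
    using that by (rule lift_Suc_antimono_le[of "\<lambda>n. dist y (q n y)"])
  have near: "dist y (q m y) \<le> dist y (d n)" if "n < m" for m n y
  proof -
    have "dist y (q (Suc n) y) \<le> dist y (d n)" by (auto simp: q_def rS)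
    then show ?thesis using anti[of "Suc n" m y] that by auto
  qed
  have "norm (y - q n y) \<le> norm y" for n y
    using anti[of 0 n y] by (simp add: q_def r0 z dist_norm)
  moreover have "(\<lambda>n. q n y) \<longlonglongrightarrow> y" if y: "y \<in> closure D" for y
  proof (rule tendstoI)
    fix e :: real assume "0 < e"
    then obtain c where "c \<in> D" "dist c y < e"
      using y unfolding closure_approachable by blast
    then obtain n where n: "dist (d n) y < e"
      using \<open>range d = insert 0 D\<close> by (metis imageE insertI2)
    show "eventually (\<lambda>m. dist (q m y) y < e) sequentially"
      using eventually_gt_at_top[of n]
      proof eventually_elim
      case (elim m)
      then show ?case using near[of n m y] n by (simp add: dist_commute)
    qed
  qed
  ultimately have "quantizer q D" using simple by (simp add: quantizer_def)
  then show thesis by (rule that)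
qed

text \<open>
  Pettis' description of strong measurability: the values of the approximating simple functions
  form a countable dense set, and conversely a quantizer for such a set does the approximation.
\<close>

lemma strongly_measurable_iff_separable_range:
  "strongly_measurable M f \<longleftrightarrow>
     f \<in> borel_measurable M \<and> (\<exists>D. countable D \<and> f ` space M \<subseteq> closure D)"
proof
  assume "strongly_measurable M f"
  then obtain s where s: "\<And>i::nat. simple_function M (s i)"
    "\<And>x. x \<in> space M \<Longrightarrow> (\<lambda>i. s i x) \<longlonglongrightarrow> f x"
    by (auto simp: strongly_measurable_def)
  have "f \<in> borel_measurable M"
    by (rule borel_measurable_LIMSEQ_metric[of s]) (use s in \<open>auto intro: borel_measurable_simple_function\<close>)
  moreover have "countable (\<Union>i. s i ` space M)"
    using s(1) by (auto simp: simple_function_def intro: countable_finite)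
  moreover have "f x \<in> closure (\<Union>i. s i ` space M)" if "x \<in> space M" for x
    using s(2)[OF that] that by (auto simp: closure_sequential intro!: exI[of _ "\<lambda>i. s i x"])
  ultimately show "f \<in> borel_measurable M \<and> (\<exists>D. countable D \<and> f ` space M \<subseteq> closure D)"
    by auto
next
  assume *: "f \<in> borel_measurable M \<and> (\<exists>D. countable D \<and> f ` space M \<subseteq> closure D)"
  then obtain D where D: "countable D" "f ` space M \<subseteq> closure D" by auto
  obtain q where "quantizer q D" using quantizer_exists[OF D(1)] .
  with * D show "strongly_measurable M f"
    unfolding strongly_measurable_def quantizer_def
    by (intro exI[of _ "\<lambda>i x. q i (f x)"]) (auto intro: simple_function_comp)
qed

lemma strongly_measurable_borel: "strongly_measurable M f \<Longrightarrow> f \<in> borel_measurable M"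
  by (simp add: strongly_measurable_iff_separable_range)

lemma strongly_measurable_norm:
  "strongly_measurable M f \<Longrightarrow> (\<lambda>x. norm (f x)) \<in> borel_measurable M"
  by (rule borel_measurable_continuous_on[OF continuous_on_norm_id, OF strongly_measurable_borel, simplified])

text \<open>
  On a nonseparable space sums and differences of Borel functions can fail to be Borel.  Working
  with limits of simple functions avoids the Borel \<open>\<sigma>\<close>-algebra of the product.
\<close>

lemma strongly_measurable_compose2:
  assumes "continuous_on UNIV (\<lambda>(a, b). c a b)"
    and f: "strongly_measurable M f" and g: "strongly_measurable M g"
  shows "strongly_measurable M (\<lambda>x. c (f x) (g x))"
proof -
  obtain s t where "\<And>i::nat. simple_function M (s i)" "\<And>i::nat. simple_function M (t i)"
    "\<And>x. x \<in> space M \<Longrightarrow> (\<lambda>i. s i x) \<longlonglongrightarrow> f x"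
    "\<And>x. x \<in> space M \<Longrightarrow> (\<lambda>i. t i x) \<longlonglongrightarrow> g x"
    using f g unfolding strongly_measurable_def by metis
  moreover have "(\<lambda>i. c (a i) (b i)) \<longlonglongrightarrow> c a' b'"
    if "a \<longlonglongrightarrow> a'" "b \<longlonglongrightarrow> b'" for a b a' b'
    using continuous_on_tendsto_compose[OF assms(1), of "\<lambda>i. (a i, b i)" "(a', b')"] that
    by (auto intro: tendsto_Pair)
  ultimately show ?thesis
    unfolding strongly_measurable_def
    by (intro exI[of _ "\<lambda>i x. c (s i x) (t i x)"]) (auto intro: simple_function_compose2)
qed

lemma strongly_measurable_add:
  "strongly_measurable M f \<Longrightarrow> strongly_measurable M g \<Longrightarrow> strongly_measurable M (\<lambda>x. f x + g x)"
  by (rule strongly_measurable_compose2) (auto simp: split_beta intro!: continuous_intros)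

lemma strongly_measurable_diff:
  "strongly_measurable M f \<Longrightarrow> strongly_measurable M g \<Longrightarrow> strongly_measurable M (\<lambda>x. f x - g x)"
  by (rule strongly_measurable_compose2) (auto simp: split_beta intro!: continuous_intros)

lemma strongly_measurable_simple: "simple_function M f \<Longrightarrow> strongly_measurable M f"
  by (auto simp: strongly_measurable_def intro!: exI[of _ "\<lambda>_. f"])

lemma strongly_measurable_indicator:
  assumes "strongly_measurable M f" and "A \<in> sets M"
  shows "strongly_measurable M (\<lambda>x. indicator A x *\<^sub>R f x)"
proof -
  obtain s where s: "\<And>i::nat. simple_function M (s i)"
    "\<And>x. x \<in> space M \<Longrightarrow> (\<lambda>i. s i x) \<longlonglongrightarrow> f x"
    using assms by (auto simp: strongly_measurable_def)
  have "simple_function M (\<lambda>x. (indicator A x :: real) *\<^sub>R s i x)" for i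
    by (rule simple_function_compose2[OF simple_function_indicator[OF assms(2)] s(1)])
  moreover have "(\<lambda>i. (indicator A x :: real) *\<^sub>R s i x) \<longlonglongrightarrow> indicator A x *\<^sub>R f x"
    if "x \<in> space M" for x
    by (intro tendsto_intros s that)
  ultimately show ?thesis
    unfolding strongly_measurable_def by (intro exI[of _ "\<lambda>i x. indicator A x *\<^sub>R s i x"]) blast
qed

lemma strongly_measurable_mono:
  fixes f :: "'a \<Rightarrow> 'b::banach"
  assumes "strongly_measurable F f" and "sets F \<subseteq> sets M" and "space F = space M"
  shows "strongly_measurable M f"
proof -
  have "simple_function M s" if "simple_function F s" for s :: "_ \<Rightarrow> 'b"
    using that assms(2,3) unfolding simple_function_def by (metis subsetD)
  then show ?thesis
    using assms(1,3) unfolding strongly_measurable_def by metis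
qed


section \<open>The Bochner integral of strongly measurable functions\<close>

abbreviation "sbi \<equiv> Bochner_Integration.simple_bochner_integral"
abbreviation "sb_integrable \<equiv> Bochner_Integration.simple_bochner_integrable"

text \<open>
  The integral over the whole space: the set integral of \<open>f\<close> over \<open>A\<close> is the
  integral of \<open>indicator A *\<^sub>R f\<close>.
\<close>

definition has_strong_integral :: "'a measure \<Rightarrow> ('a \<Rightarrow> 'b::banach) \<Rightarrow> 'b \<Rightarrow> bool" where
  "has_strong_integral M f v \<longleftrightarrow> strongly_measurable M f \<and>
     (\<exists>s. (\<forall>i::nat. sb_integrable M (s i)) \<and>
          (\<lambda>i. \<integral>\<^sup>+ x. ennreal (norm (f x - s i x)) \<partial>M) \<longlonglongrightarrow> 0 \<and>
          (\<lambda>i. sbi M (s i)) \<longlonglongrightarrow> v)"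

lemma has_set_bochner_integral_iff:
  "has_set_bochner_integral M A f v \<longleftrightarrow> has_strong_integral M (\<lambda>x. indicator A x *\<^sub>R f x) v"
  by (simp add: has_set_bochner_integral_def has_strong_integral_def)

lemma sb_integrable_simple: "sb_integrable M s \<Longrightarrow> simple_function M s"
  by (auto elim: simple_bochner_integrable.cases)

lemma norm_sbi_diff_le:
  fixes s t :: "'a \<Rightarrow> 'b::real_normed_vector"
  assumes s: "sb_integrable M s" and t: "sb_integrable M t"
  shows "ennreal (norm (sbi M s - sbi M t)) \<le> (\<integral>\<^sup>+ x. ennreal (norm (s x - t x)) \<partial>M)"
proof -
  have st: "sb_integrable M (\<lambda>x. s x - t x)"
    by (rule simple_bochner_integrable_compose2) (use s t in auto)
  have n: "sb_integrable M (\<lambda>x. norm (s x - t x))"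
    by (rule simple_bochner_integrable_compose2[where p="\<lambda>a b. norm a", OF _ st st]) auto
  have "norm (sbi M s - sbi M t) \<le> sbi M (\<lambda>x. norm (s x - t x))"
    using simple_bochner_integral_norm_bound[OF st] simple_bochner_integral_diff[OF s t] by simp
  then have "ennreal (norm (sbi M s - sbi M t)) \<le> ennreal (sbi M (\<lambda>x. norm (s x - t x)))"
    by (rule ennreal_leI)
  also have "\<dots> = (\<integral>\<^sup>+ x. ennreal (norm (s x - t x)) \<partial>M)"
    by (rule simple_bochner_integral_eq_nn_integral[OF n]) simp
  finally show ?thesis .
qed

lemma nn_integral_norm_diff_triangle:
  fixes f g h :: "'a \<Rightarrow> 'b::banach"
  assumes f: "strongly_measurable M f" and g: "strongly_measurable M g"
    and h: "strongly_measurable M h"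
  shows "(\<integral>\<^sup>+ x. ennreal (norm (f x - h x)) \<partial>M)
    \<le> (\<integral>\<^sup>+ x. ennreal (norm (f x - g x)) \<partial>M) + (\<integral>\<^sup>+ x. ennreal (norm (g x - h x)) \<partial>M)"
proof -
  note [measurable] = strongly_measurable_norm[OF strongly_measurable_diff[OF f g]]
    strongly_measurable_norm[OF strongly_measurable_diff[OF g h]]
  have "ennreal (norm (f x - h x)) \<le> ennreal (norm (f x - g x)) + ennreal (norm (g x - h x))" for x
    using norm_triangle_ineq[of "f x - g x" "g x - h x"]
    by (simp flip: ennreal_plus)
  then have "(\<integral>\<^sup>+ x. ennreal (norm (f x - h x)) \<partial>M) \<le>
      (\<integral>\<^sup>+ x. ennreal (norm (f x - g x)) + ennreal (norm (g x - h x)) \<partial>M)"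
    by (rule nn_integral_mono)
  also have "\<dots> = (\<integral>\<^sup>+ x. ennreal (norm (f x - g x)) \<partial>M) + (\<integral>\<^sup>+ x. ennreal (norm (g x - h x)) \<partial>M)"
    by (rule nn_integral_add) measurable
  finally show ?thesis .
qed

text \<open>
  Integration is a contraction from \<open>L\<^sup>1\<close> to \<open>B\<close>.  Uniqueness of the integral (equal functions) and
  the norm bound (second function zero) are special cases, and so is the approximation
  argument behind the submartingale property of the norm.
\<close>

lemma norm_strong_integral_diff_le:
  fixes f g :: "'a \<Rightarrow> 'b::banach"
  assumes f: "has_strong_integral M f v" and g: "has_strong_integral M g w"
  shows "ennreal (norm (v - w)) \<le> (\<integral>\<^sup>+ x. ennreal (norm (f x - g x)) \<partial>M)" (is "_ \<le> ?I")
proof -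
  obtain s where s: "\<And>i::nat. sb_integrable M (s i)"
      "(\<lambda>i. \<integral>\<^sup>+ x. ennreal (norm (f x - s i x)) \<partial>M) \<longlonglongrightarrow> 0" "(\<lambda>i. sbi M (s i)) \<longlonglongrightarrow> v"
    using f by (auto simp: has_strong_integral_def)
  obtain t where t: "\<And>i::nat. sb_integrable M (t i)"
      "(\<lambda>i. \<integral>\<^sup>+ x. ennreal (norm (g x - t i x)) \<partial>M) \<longlonglongrightarrow> 0" "(\<lambda>i. sbi M (t i)) \<longlonglongrightarrow> w"
    using g by (auto simp: has_strong_integral_def)
  have sm: "strongly_measurable M f" "strongly_measurable M g"
    "strongly_measurable M (s i)" "strongly_measurable M (t i)" for i
    using f g s(1) t(1)
    by (auto simp: has_strong_integral_def intro: strongly_measurable_simple sb_integrable_simple)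
  have "ennreal (norm (sbi M (s i) - sbi M (t i))) \<le>
     (\<integral>\<^sup>+ x. ennreal (norm (f x - s i x)) \<partial>M) + (?I + (\<integral>\<^sup>+ x. ennreal (norm (g x - t i x)) \<partial>M))" for i
  proof -
    have "ennreal (norm (sbi M (s i) - sbi M (t i))) \<le> (\<integral>\<^sup>+ x. ennreal (norm (s i x - t i x)) \<partial>M)"
      by (rule norm_sbi_diff_le[OF s(1) t(1)])
    also have "\<dots> \<le> (\<integral>\<^sup>+ x. ennreal (norm (s i x - f x)) \<partial>M) + (\<integral>\<^sup>+ x. ennreal (norm (f x - t i x)) \<partial>M)"
      by (intro nn_integral_norm_diff_triangle sm)
    also have "(\<integral>\<^sup>+ x. ennreal (norm (f x - t i x)) \<partial>M) \<le> ?I + (\<integral>\<^sup>+ x. ennreal (norm (g x - t i x)) \<partial>M)"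
      by (intro nn_integral_norm_diff_triangle sm)
    finally show ?thesis by (simp add: norm_minus_commute add_left_mono)
  qed
  moreover have "(\<lambda>i. ennreal (norm (sbi M (s i) - sbi M (t i)))) \<longlonglongrightarrow> ennreal (norm (v - w))"
    by (intro tendsto_ennrealI tendsto_norm tendsto_diff s t)
  moreover have "(\<lambda>i. (\<integral>\<^sup>+ x. ennreal (norm (f x - s i x)) \<partial>M) + (?I + (\<integral>\<^sup>+ x. ennreal (norm (g x - t i x)) \<partial>M)))
      \<longlonglongrightarrow> 0 + (?I + 0)"
    by (intro tendsto_add tendsto_const s t)
  ultimately show ?thesis
    by (metis (no_types, lifting) LIMSEQ_le add.left_neutral add.right_neutral)
qed

lemma has_strong_integral_unique:
  assumes "has_strong_integral M f v" and "has_strong_integral M f w"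
  shows "v = w"
  using norm_strong_integral_diff_le[OF assms] by simp

lemma has_strong_integral_simple:
  "sb_integrable M s \<Longrightarrow> has_strong_integral M s (sbi M s)"
  unfolding has_strong_integral_def
  by (intro conjI strongly_measurable_simple sb_integrable_simple exI[of _ "\<lambda>_. s"]) auto

lemma has_strong_integral_0: "has_strong_integral M (\<lambda>_. 0 :: 'b::banach) 0"
proof -
  have "sb_integrable M (\<lambda>_. 0 :: 'b)" by (auto intro: simple_bochner_integrable.intros)
  moreover have "sbi M (\<lambda>_. 0 :: 'b) = 0"
    unfolding Bochner_Integration.simple_bochner_integral_def by (rule sum.neutral) auto
  ultimately show ?thesis by (metis has_strong_integral_simple)
qed

lemma norm_strong_integral_le:
  fixes f :: "'a \<Rightarrow> 'b::banach"
  assumes "has_strong_integral M f v"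
  shows "ennreal (norm v) \<le> (\<integral>\<^sup>+ x. ennreal (norm (f x)) \<partial>M)"
  using norm_strong_integral_diff_le[OF assms has_strong_integral_0] by simp

lemma has_strong_integral_const:
  fixes d :: "'b::banach"
  assumes "E \<in> sets M" and "emeasure M E < \<infinity>"
  shows "has_strong_integral M (\<lambda>x. indicator E x *\<^sub>R d) (measure M E *\<^sub>R d)"
proof -
  have "{x \<in> space M. indicator E x \<noteq> (0::real)} = E"
    using sets.sets_into_space[OF assms(1)] by (auto split: split_indicator)
  then have int: "sb_integrable M (indicator E :: 'a \<Rightarrow> real)"
    using assms by (auto intro!: simple_bochner_integrable.intros)
  then have int': "sb_integrable M (\<lambda>x. (indicator E x :: real) *\<^sub>R d)"
    by (rule simple_bochner_integrable_compose2[where p="\<lambda>a b. a *\<^sub>R d", rotated]) (use int in auto)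
  have "ennreal (sbi M (indicator E)) = (\<integral>\<^sup>+ x. ennreal (indicator E x) \<partial>M)"
    by (rule simple_bochner_integral_eq_nn_integral[OF int]) simp
  also have "\<dots> = emeasure M E" using assms(1) by (simp add: ennreal_indicator)
  finally have "sbi M (indicator E) = measure M E"
    by (metis Bochner_Integration.simple_bochner_integral_nonneg indicator_pos_le enn2real_ennreal measure_def)
  moreover have "sbi M (\<lambda>x. indicator E x *\<^sub>R d) = sbi M (indicator E) *\<^sub>R d"
    by (rule simple_bochner_integral_linear[OF _ int, of "\<lambda>r. r *\<^sub>R d"])
       (auto intro!: linearI simp: scaleR_add_left)
  ultimately show ?thesis using has_strong_integral_simple[OF int'] by simp
qed

lemma has_strong_integral_add:
  fixes f g :: "'a \<Rightarrow> 'b::banach"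
  assumes f: "has_strong_integral M f v" and g: "has_strong_integral M g w"
  shows "has_strong_integral M (\<lambda>x. f x + g x) (v + w)"
proof -
  obtain s where s: "\<And>i::nat. sb_integrable M (s i)"
      "(\<lambda>i. \<integral>\<^sup>+ x. ennreal (norm (f x - s i x)) \<partial>M) \<longlonglongrightarrow> 0" "(\<lambda>i. sbi M (s i)) \<longlonglongrightarrow> v"
    using f by (auto simp: has_strong_integral_def)
  obtain t where t: "\<And>i::nat. sb_integrable M (t i)"
      "(\<lambda>i. \<integral>\<^sup>+ x. ennreal (norm (g x - t i x)) \<partial>M) \<longlonglongrightarrow> 0" "(\<lambda>i. sbi M (t i)) \<longlonglongrightarrow> w"
    using g by (auto simp: has_strong_integral_def)
  have sm: "strongly_measurable M f" "strongly_measurable M g"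
    "strongly_measurable M (s i)" "strongly_measurable M (t i)" for i
    using f g s(1) t(1)
    by (auto simp: has_strong_integral_def intro: strongly_measurable_simple sb_integrable_simple)
  have st: "sb_integrable M (\<lambda>x. s i x + t i x)" for i
    by (rule simple_bochner_integrable_compose2) (use s t in auto)
  have "(\<integral>\<^sup>+ x. ennreal (norm (f x + g x - (s i x + t i x))) \<partial>M) \<le>
     (\<integral>\<^sup>+ x. ennreal (norm (f x - s i x)) \<partial>M) + (\<integral>\<^sup>+ x. ennreal (norm (g x - t i x)) \<partial>M)" for i
  proof -
    have "(\<integral>\<^sup>+ x. ennreal (norm (f x + g x - (s i x + t i x))) \<partial>M) \<le>
        (\<integral>\<^sup>+ x. ennreal (norm (f x + g x - (s i x + g x))) \<partial>M) +
        (\<integral>\<^sup>+ x. ennreal (norm (s i x + g x - (s i x + t i x))) \<partial>M)"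
      by (intro nn_integral_norm_diff_triangle strongly_measurable_add sm)
    then show ?thesis by simp
  qed
  moreover have "(\<lambda>i. (\<integral>\<^sup>+ x. ennreal (norm (f x - s i x)) \<partial>M) + (\<integral>\<^sup>+ x. ennreal (norm (g x - t i x)) \<partial>M))
      \<longlonglongrightarrow> 0"
    using tendsto_add[OF s(2) t(2)] by simp
  ultimately have "(\<lambda>i. \<integral>\<^sup>+ x. ennreal (norm (f x + g x - (s i x + t i x))) \<partial>M) \<longlonglongrightarrow> 0"
    using tendsto_sandwich[of "\<lambda>_. 0" "\<lambda>i. \<integral>\<^sup>+ x. ennreal (norm (f x + g x - (s i x + t i x))) \<partial>M" sequentially
      "\<lambda>i. (\<integral>\<^sup>+ x. ennreal (norm (f x - s i x)) \<partial>M) + (\<integral>\<^sup>+ x. ennreal (norm (g x - t i x)) \<partial>M)" 0]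
    by simp
  moreover have "(\<lambda>i. sbi M (\<lambda>x. s i x + t i x)) \<longlonglongrightarrow> v + w"
    unfolding simple_bochner_integral_add[OF s(1) t(1)] by (intro tendsto_add s t)
  ultimately show ?thesis
    unfolding has_strong_integral_def
    using st by (intro conjI strongly_measurable_add sm exI[of _ "\<lambda>i x. s i x + t i x"]) auto
qed

lemma has_strong_integral_sum:
  fixes f :: "'i \<Rightarrow> 'a \<Rightarrow> 'b::banach"
  assumes "\<And>i. i \<in> I \<Longrightarrow> has_strong_integral M (f i) (v i)"
  shows "has_strong_integral M (\<lambda>x. \<Sum>i\<in>I. f i x) (\<Sum>i\<in>I. v i)"
  using assms
  by (induction I rule: infinite_finite_induct) (auto intro: has_strong_integral_add has_strong_integral_0)

lemma has_strong_integral_cong_AE: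
  fixes f g :: "'a \<Rightarrow> 'b::banach"
  assumes "has_strong_integral M f v" and "strongly_measurable M g" and "AE x in M. f x = g x"
  shows "has_strong_integral M g v"
proof -
  have "(\<integral>\<^sup>+ x. ennreal (norm (g x - s x)) \<partial>M) = (\<integral>\<^sup>+ x. ennreal (norm (f x - s x)) \<partial>M)" for s
    by (rule nn_integral_cong_AE) (use assms(3) in eventually_elim, simp)
  then show ?thesis
    using assms(1,2) unfolding has_strong_integral_def by simp
qed

text \<open>
  Besides existence, what matters is that the approximating simple functions have the form
  \<open>q i \<circ> f\<close>, with \<open>q\<close> chosen from the range of \<open>f\<close> alone.  Convergence in \<open>L\<^sup>1\<close> is dominated
  convergence; completeness of \<open>B\<close> gives the limit of the integrals.
\<close>

lemma quantizer_strong_integral: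
  fixes f :: "'a \<Rightarrow> 'b::banach"
  assumes q: "quantizer q D" and f: "strongly_measurable M f" "f ` space M \<subseteq> closure D"
    and fin: "(\<integral>\<^sup>+ x. ennreal (norm (f x)) \<partial>M) < \<infinity>"
  obtains v where "has_strong_integral M f v" "(\<lambda>i. sbi M (\<lambda>x. q i (f x))) \<longlonglongrightarrow> v"
proof -
  define s where "s i x = q i (f x)" for i x
  have simple: "simple_function M (s i)" for i
    unfolding s_def using q strongly_measurable_borel[OF f(1)]
    by (auto simp: quantizer_def intro: simple_function_comp)
  have sm: "strongly_measurable M (s i)" for i by (rule strongly_measurable_simple[OF simple])
  have near: "norm (f x - s i x) \<le> norm (f x)" for i x
    using q by (simp add: s_def quantizer_def)
  have small: "norm (s i x) \<le> 2 * norm (f x)" for i x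
    using near[of x i] norm_triangle_ineq4[of "f x" "f x - s i x"] by simp
  note [measurable] = strongly_measurable_norm[OF f(1)]
    strongly_measurable_norm[OF strongly_measurable_diff[OF f(1) sm]]
  have int: "sb_integrable M (s i)" for i
  proof (rule simple_bochner_integrableI_bounded[OF simple])
    have "(\<integral>\<^sup>+ x. ennreal (norm (s i x)) \<partial>M) \<le> (\<integral>\<^sup>+ x. 2 * ennreal (norm (f x)) \<partial>M)"
      using small by (intro nn_integral_mono) (metis ennreal_leI ennreal_mult' ennreal_numeral zero_le_numeral)
    also have "\<dots> < \<infinity>" using fin by (simp add: nn_integral_cmult ennreal_mult_less_top)
    finally show "(\<integral>\<^sup>+ x. ennreal (norm (s i x)) \<partial>M) < \<infinity>" .
  qed
  define a where "a i = (\<integral>\<^sup>+ x. ennreal (norm (f x - s i x)) \<partial>M)" for i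
  have "a \<longlonglongrightarrow> (\<integral>\<^sup>+ x. 0 \<partial>M)"
    unfolding a_def
  proof (rule nn_integral_dominated_convergence[where w="\<lambda>x. ennreal (norm (f x))"])
    have "(\<lambda>i. ennreal (norm (f x - s i x))) \<longlonglongrightarrow> 0" if "x \<in> space M" for x
    proof -
      have "(\<lambda>i. s i x) \<longlonglongrightarrow> f x"
        using q f(2) that by (auto simp: s_def quantizer_def)
      then have "(\<lambda>i. ennreal (norm (f x - s i x))) \<longlonglongrightarrow> ennreal (norm (f x - f x))"
        by (intro tendsto_ennrealI tendsto_norm tendsto_diff tendsto_const)
      then show ?thesis by simp
    qed
    then show "AE x in M. (\<lambda>i. ennreal (norm (f x - s i x))) \<longlonglongrightarrow> 0"
      by (rule AE_I2)
  qed (use fin near in \<open>auto intro!: ennreal_leI\<close>)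
  then have a0: "a \<longlonglongrightarrow> 0" by simp
  have "Cauchy (\<lambda>i. sbi M (s i))"
  proof (rule metric_CauchyI)
    fix e :: real assume "0 < e"
    then have "eventually (\<lambda>i. a i < ennreal (e/2)) sequentially"
      by (intro order_tendstoD[OF a0]) simp
    then obtain N where N: "\<And>i. N \<le> i \<Longrightarrow> a i < ennreal (e/2)"
      by (auto simp: eventually_sequentially)
    have "dist (sbi M (s i)) (sbi M (s j)) < e" if "N \<le> i" "N \<le> j" for i j
    proof -
      have "ennreal (norm (sbi M (s i) - sbi M (s j))) \<le> (\<integral>\<^sup>+ x. ennreal (norm (s i x - s j x)) \<partial>M)"
        by (rule norm_sbi_diff_le[OF int int])
      also have "\<dots> \<le> (\<integral>\<^sup>+ x. ennreal (norm (s i x - f x)) \<partial>M) + (\<integral>\<^sup>+ x. ennreal (norm (f x - s j x)) \<partial>M)"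
        by (intro nn_integral_norm_diff_triangle sm f)
      also have "\<dots> = a i + a j" by (simp add: a_def norm_minus_commute)
      also have "\<dots> < ennreal (e/2) + ennreal (e/2)"
        by (intro add_strict_mono N that)
      also have "\<dots> = ennreal e" using \<open>0 < e\<close> by (simp flip: ennreal_plus)
      finally show ?thesis using \<open>0 < e\<close> by (simp add: dist_norm ennreal_less_iff)
    qed
    then show "\<exists>N. \<forall>i\<ge>N. \<forall>j\<ge>N. dist (sbi M (s i)) (sbi M (s j)) < e" by blast
  qed
  then obtain v where "(\<lambda>i. sbi M (s i)) \<longlonglongrightarrow> v"
    by (auto simp: Cauchy_convergent_iff convergent_def)
  with a0 int have "has_strong_integral M f v"
    unfolding has_strong_integral_def a_def using f(1) by blast
  with \<open>(\<lambda>i. sbi M (s i)) \<longlonglongrightarrow> v\<close> show thesis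
    by (intro that) (simp_all add: s_def[abs_def])
qed

text \<open>
  Simple functions on the source that approximate \<open>f \<circ> \<phi>\<close> need not factor through \<open>\<phi>\<close>.  The
  functions \<open>q i \<circ> f \<circ> \<phi>\<close> do, and their integrals agree with those of \<open>q i \<circ> f\<close> term by term.
\<close>

lemma has_strong_integral_distr:
  fixes f :: "'c \<Rightarrow> 'b::banach"
  assumes \<phi> [measurable]: "\<phi> \<in> measurable M N" and f: "strongly_measurable N f"
    and int: "has_strong_integral M (\<lambda>x. f (\<phi> x)) v"
    and fin: "(\<integral>\<^sup>+ x. ennreal (norm (f (\<phi> x))) \<partial>M) < \<infinity>"
  shows "has_strong_integral (distr M N \<phi>) f v"
proof -
  let ?M' = "distr M N \<phi>"
  obtain D where D: "countable D" "f ` space N \<subseteq> closure D"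
    using f by (auto simp: strongly_measurable_iff_separable_range)
  obtain q where q: "quantizer q D" by (rule quantizer_exists[OF D(1)])
  note [measurable] = strongly_measurable_norm[OF f]
  have f': "strongly_measurable ?M' f"
    by (rule strongly_measurable_mono[OF f]) auto
  have fin': "(\<integral>\<^sup>+ x. ennreal (norm (f x)) \<partial>?M') < \<infinity>"
    using fin by (subst nn_integral_distr) auto
  obtain w where w: "has_strong_integral ?M' f w" "(\<lambda>i. sbi ?M' (\<lambda>x. q i (f x))) \<longlonglongrightarrow> w"
    by (rule quantizer_strong_integral[OF q f' _ fin']) (use D in auto)
  have "strongly_measurable M (\<lambda>x. f (\<phi> x))" using int by (simp add: has_strong_integral_def)
  from quantizer_strong_integral[OF q this _ fin]
  obtain u where u: "has_strong_integral M (\<lambda>x. f (\<phi> x)) u"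
      "(\<lambda>i. sbi M (\<lambda>x. q i (f (\<phi> x)))) \<longlonglongrightarrow> u"
    using D measurable_space[OF \<phi>] by blast
  have "sbi ?M' s = sbi M (\<lambda>x. s (\<phi> x))" if s: "simple_function N s" for s :: "'c \<Rightarrow> 'b"
  proof -
    have m: "measure ?M' {x \<in> space N. s x = y} = measure M {x \<in> space M. s (\<phi> x) = y}" for y
    proof -
      have "s -` {y} \<inter> space N \<in> sets N" by (rule simple_functionD(2)[OF s])
      moreover have "s -` {y} \<inter> space N = {x \<in> space N. s x = y}" by auto
      moreover have "\<phi> -` {x \<in> space N. s x = y} \<inter> space M = {x \<in> space M. s (\<phi> x) = y}"
        using measurable_space[OF \<phi>] by auto
      ultimately show ?thesis using \<phi> by (simp add: measure_distr)
    qed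
    have e: "{x \<in> space M. s (\<phi> x) = y} = {}" if "y \<notin> (\<lambda>x. s (\<phi> x)) ` space M" for y
      using that by auto
    show ?thesis
      unfolding Bochner_Integration.simple_bochner_integral_def space_distr m
    proof (rule sum.mono_neutral_right)
      show "finite (s ` space N)" by (rule simple_functionD(1)[OF s])
      show "(\<lambda>x. s (\<phi> x)) ` space M \<subseteq> s ` space N" using measurable_space[OF \<phi>] by auto
      show "\<forall>y\<in>s ` space N - (\<lambda>x. s (\<phi> x)) ` space M. measure M {x \<in> space M. s (\<phi> x) = y} *\<^sub>R y = 0"
      proof
        fix y assume "y \<in> s ` space N - (\<lambda>x. s (\<phi> x)) ` space M"
        then have "{x \<in> space M. s (\<phi> x) = y} = {}" by (intro e) simp
        then show "measure M {x \<in> space M. s (\<phi> x) = y} *\<^sub>R y = 0"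
          by (simp only: measure_empty scaleR_zero_left)
      qed
    qed
  qed
  moreover have "simple_function N (\<lambda>x. q i (f x))" for i
    using q strongly_measurable_borel[OF f] by (auto simp: quantizer_def intro: simple_function_comp)
  ultimately have "(\<lambda>i. sbi ?M' (\<lambda>x. q i (f x))) \<longlonglongrightarrow> u" using u(2) by simp
  with w(2) have "u = w" by (metis LIMSEQ_unique)
  with w u(1) int show ?thesis by (metis has_strong_integral_unique)
qed


section \<open>Adapted martingales and Doob's inequality\<close>

text \<open>
  A martingale indexed by all natural numbers whose members are themselves measurable for the
  filtration, and not only almost everywhere equal to such functions.  Exact adaptedness makes
  first-entrance times honest stopping times.
\<close>

locale adapted_martingale =
  fixes M :: "'a measure" and G :: "nat \<Rightarrow> 'a measure" and h :: "nat \<Rightarrow> 'a \<Rightarrow> 'b::banach"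
  assumes subalgebra: "sigma_finite_subalgebra M (G i)"
    and filtration: "i \<le> j \<Longrightarrow> sets (G i) \<subseteq> sets (G j)"
    and adapted: "strongly_measurable (G i) (h i)"
    and locally_integrable:
      "A \<in> sets M \<Longrightarrow> emeasure M A < \<infinity> \<Longrightarrow> (\<integral>\<^sup>+ x\<in>A. ennreal (norm (h i x)) \<partial>M) < \<infinity>"
    and same_integrals: "i \<le> j \<Longrightarrow> A \<in> sets (G i) \<Longrightarrow> emeasure M A < \<infinity> \<Longrightarrow>
      \<exists>v. has_set_bochner_integral M A (h i) v \<and> has_set_bochner_integral M A (h j) v"
begin

lemma space_G [simp]: "space (G i) = space M"
  using subalgebra[of i] by (simp add: sigma_finite_subalgebra_def subalgebra_def)

lemma sets_G: "A \<in> sets (G i) \<Longrightarrow> A \<in> sets M"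
  using subalgebra[of i] by (auto simp: sigma_finite_subalgebra_def subalgebra_def)

lemma strongly_measurable_M: "strongly_measurable M (h i)"
  by (rule strongly_measurable_mono[OF adapted]) (auto intro: sets_G)

lemma strongly_measurable_later: "i \<le> j \<Longrightarrow> strongly_measurable (G j) (h i)"
  by (rule strongly_measurable_mono[OF adapted]) (use filtration in auto)

lemma norm_h_measurable [measurable]: "(\<lambda>x. norm (h i x)) \<in> borel_measurable M"
  by (rule strongly_measurable_norm[OF strongly_measurable_M])

lemma measurable_G_imp_M: "f \<in> measurable (G i) N \<Longrightarrow> f \<in> measurable M N"
  using sets_G by (fastforce simp: measurable_def)

lemma finite_cover:
  obtains X :: "nat \<Rightarrow> 'a set"
  where "\<And>k. X k \<in> sets (G 0)" "(\<Union>k. X k) = space M" "\<And>k. emeasure M (X k) < \<infinity>"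
    "disjoint_family X"
proof -
  interpret sigma_finite_subalgebra M "G 0" by (rule subalgebra)
  obtain X :: "nat \<Rightarrow> 'a set" where X: "range X \<subseteq> sets (restr_to_subalg M (G 0))"
    "(\<Union>i. X i) = space (restr_to_subalg M (G 0))"
    "\<And>i. emeasure (restr_to_subalg M (G 0)) (X i) \<noteq> \<infinity>" "disjoint_family X"
    using sigma_finite_measure.sigma_finite_disjoint[OF sigma_fin_subalg] by metis
  have "X k \<in> sets (G 0)" for k
    using X(1) sets_restr_to_subalg[OF subalg] by auto
  moreover have "emeasure M (X k) < \<infinity>" for k
    using X(3)[of k] emeasure_restr_to_subalg[OF subalg calculation[of k]]
    by (simp add: less_top)
  ultimately show thesis
    using that X(2,4) by (metis space_restr_to_subalg)
qed

text \<open>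
  Jensen's inequality for the norm, on a set where the earlier function is nearly a constant \<open>d\<close>:
  there the integral of its norm is close to \<open>norm d\<close> times the measure, which is close to the norm of
  the integral, and the integral is the same for the later function.
\<close>

lemma norm_submartingale_near_point:
  assumes ij: "i \<le> j" and E: "E \<in> sets (G i)" and fin: "emeasure M E < \<infinity>"
    and near: "\<And>x. x \<in> E \<Longrightarrow> norm (h i x - d) \<le> e" and "0 \<le> e"
  shows "(\<integral>\<^sup>+ x\<in>E. ennreal (norm (h i x)) \<partial>M)
    \<le> (\<integral>\<^sup>+ x\<in>E. ennreal (norm (h j x)) \<partial>M) + 2 * ennreal e * emeasure M E"
proof -
  have EM [measurable]: "E \<in> sets M" by (rule sets_G[OF E])
  obtain v where v: "has_strong_integral M (\<lambda>x. indicator E x *\<^sub>R h i x) v"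
    "has_strong_integral M (\<lambda>x. indicator E x *\<^sub>R h j x) v"
    using same_integrals[OF ij E fin] by (auto simp: has_set_bochner_integral_iff)
  have "ennreal (norm (measure M E *\<^sub>R d - v)) \<le>
      (\<integral>\<^sup>+ x. ennreal (norm (indicator E x *\<^sub>R d - indicator E x *\<^sub>R h i x)) \<partial>M)"
    by (rule norm_strong_integral_diff_le[OF has_strong_integral_const v(1)]) (use fin in auto)
  also have "\<dots> \<le> (\<integral>\<^sup>+ x. ennreal e * indicator E x \<partial>M)"
    using near by (intro nn_integral_mono) (auto split: split_indicator simp: norm_minus_commute intro!: ennreal_leI)
  also have "\<dots> = ennreal e * emeasure M E" by (rule nn_integral_cmult_indicator[OF EM])
  finally have d1: "ennreal (norm (measure M E *\<^sub>R d - v)) \<le> ennreal e * emeasure M E" .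
  have vj: "ennreal (norm v) \<le> (\<integral>\<^sup>+ x\<in>E. ennreal (norm (h j x)) \<partial>M)"
    using norm_strong_integral_le[OF v(2)]
    by (simp add: ennreal_mult' mult.commute ennreal_indicator)
  have "(\<integral>\<^sup>+ x\<in>E. ennreal (norm (h i x)) \<partial>M) \<le> (\<integral>\<^sup>+ x. ennreal (norm d + e) * indicator E x \<partial>M)"
  proof (intro nn_integral_mono)
    fix x
    have "norm (h i x) \<le> norm d + e" if "x \<in> E"
      using near[OF that] norm_triangle_sub[of "h i x" d] by simp
    then show "ennreal (norm (h i x)) * indicator E x \<le> ennreal (norm d + e) * indicator E x"
      by (auto split: split_indicator intro!: ennreal_leI)
  qed
  also have "\<dots> = ennreal (norm d + e) * emeasure M E" by (rule nn_integral_cmult_indicator[OF EM])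
  also have "\<dots> = ennreal (norm (measure M E *\<^sub>R d)) + ennreal e * emeasure M E"
    using fin \<open>0 \<le> e\<close> by (simp add: ennreal_plus distrib_right emeasure_eq_ennreal_measure less_top
        ennreal_mult' mult.commute distrib_left)
  also have "ennreal (norm (measure M E *\<^sub>R d)) \<le> ennreal (norm (measure M E *\<^sub>R d - v)) + ennreal (norm v)"
    using norm_triangle_sub[of "measure M E *\<^sub>R d" v] by (simp add: add.commute flip: ennreal_plus)
  also have "\<dots> \<le> ennreal e * emeasure M E + (\<integral>\<^sup>+ x\<in>E. ennreal (norm (h j x)) \<partial>M)"
    by (rule add_mono[OF d1 vj])
  finally show ?thesis
    by (simp add: algebra_simps mult_2 add_right_mono distrib_right)
qed

text \<open>
  Strong measurability splits \<open>A\<close> into countably many sets of the \<open>\<sigma>\<close>-algebra on which the earlier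
  function is constant up to \<open>r\<close>.  The errors \<open>2 * r\<close> times the measure of the pieces add up to at most
  the given \<open>e\<close>.
\<close>

lemma norm_submartingale_finite:
  assumes ij: "i \<le> j" and A: "A \<in> sets (G i)" and fin: "emeasure M A < \<infinity>"
  shows "(\<integral>\<^sup>+ x\<in>A. ennreal (norm (h i x)) \<partial>M) \<le> (\<integral>\<^sup>+ x\<in>A. ennreal (norm (h j x)) \<partial>M)"
    (is "?I \<le> ?J")
proof (rule ennreal_le_epsilon)
  fix e :: real assume "0 < e"
  \<comment> \<open>The summand 1 keeps the denominator positive when \<open>A\<close> is a null set.\<close>
  define r where "r = e / (2 * (measure M A + 1))"
  have "0 < r" unfolding r_def using \<open>0 < e\<close> by (simp add: add_nonneg_pos)
  obtain D where D: "countable D" "h i ` space M \<subseteq> closure D"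
    using strongly_measurable_M[of i] by (auto simp: strongly_measurable_iff_separable_range)
  define d where "d = from_nat_into (insert 0 D)"
  have d: "range d = insert 0 D"
    unfolding d_def using D(1) by (intro range_from_nat_into) auto
  define E where "E k = {x \<in> A. norm (h i x - d k) \<le> r}" for k
  have E_sets: "E k \<in> sets (G i)" for k
  proof -
    have "strongly_measurable (G i) (\<lambda>x. h i x - d k)"
      by (intro strongly_measurable_diff adapted strongly_measurable_simple) simp
    note [measurable] = strongly_measurable_norm[OF this] A
    have "A \<inter> {x \<in> space (G i). norm (h i x - d k) \<le> r} \<in> sets (G i)" by measurable
    moreover have "A \<inter> {x \<in> space (G i). norm (h i x - d k) \<le> r} = E k"
      using sets.sets_into_space[OF A] by (auto simp: E_def)
    ultimately show ?thesis by simp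
  qed
  define F where "F = disjointed E"
  have F_sets: "F k \<in> sets (G i)" for k
    using sets.range_disjointed_sets[of E "G i"] E_sets by (auto simp: F_def)
  have F_sub: "F k \<subseteq> E k" for k unfolding F_def by (rule disjointed_subset)
  then have F_A: "F k \<subseteq> A" for k by (auto simp: E_def)
  have [measurable]: "F k \<in> sets M" "A \<in> sets M" for k using F_sets A by (auto intro: sets_G)
  have UF: "(\<Union>k. F k) = A"
  proof -
    have "\<exists>k. norm (h i x - d k) \<le> r" if "x \<in> A" for x
    proof -
      have "h i x \<in> closure D" using D(2) sets.sets_into_space[OF A] that by auto
      then obtain c where "c \<in> D" "dist c (h i x) < r"
        using \<open>0 < r\<close> unfolding closure_approachable by blast
      then show ?thesis using d by (metis dist_commute dist_norm imageE insertI2 less_imp_le)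
    qed
    then show ?thesis unfolding F_def UN_disjointed_eq by (auto simp: E_def)
  qed
  have disj: "disjoint_family F" unfolding F_def by (rule disjoint_family_disjointed)
  have split: "(\<integral>\<^sup>+ x\<in>A. u x \<partial>M) = (\<Sum>k. \<integral>\<^sup>+ x\<in>F k. u x \<partial>M)"
    if [measurable]: "u \<in> borel_measurable M" for u :: "'a \<Rightarrow> ennreal"
    using nn_integral_disjoint_family[of u M F] disj UF by simp
  have finF: "emeasure M (F k) < \<infinity>" for k
    using emeasure_mono[OF F_A[of k], of M] fin by (auto intro: le_less_trans)
  have "?I = (\<Sum>k. \<integral>\<^sup>+ x\<in>F k. ennreal (norm (h i x)) \<partial>M)" by (rule split) measurable
  also have "\<dots> \<le> (\<Sum>k. (\<integral>\<^sup>+ x\<in>F k. ennreal (norm (h j x)) \<partial>M) + 2 * ennreal r * emeasure M (F k))"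
    using \<open>0 < r\<close> F_sub
    by (intro suminf_le norm_submartingale_near_point[OF ij F_sets finF, where e=r]) (auto simp: E_def)
  also have "\<dots> = (\<Sum>k. \<integral>\<^sup>+ x\<in>F k. ennreal (norm (h j x)) \<partial>M) + (\<Sum>k. 2 * ennreal r * emeasure M (F k))"
    by (rule suminf_add[symmetric]) auto
  also have "(\<Sum>k. \<integral>\<^sup>+ x\<in>F k. ennreal (norm (h j x)) \<partial>M) = ?J" by (rule split[symmetric]) measurable
  also have "(\<Sum>k. 2 * ennreal r * emeasure M (F k)) = 2 * ennreal r * emeasure M A"
    using suminf_emeasure[of F M] disj UF by (simp add: ennreal_suminf_cmult image_subset_iff)
  also have "2 * ennreal r * emeasure M A = ennreal (2 * r * measure M A)"
    using fin \<open>0 < r\<close> by (simp add: emeasure_eq_ennreal_measure less_top ennreal_mult)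
  also have "\<dots> \<le> ennreal e"
  proof (rule ennreal_leI)
    have "2 * r * measure M A \<le> 2 * r * (measure M A + 1)"
      using \<open>0 < r\<close> by (intro mult_left_mono) auto
    also have "\<dots> = e" unfolding r_def by (simp add: field_simps add_nonneg_eq_0_iff)
    finally show "2 * r * measure M A \<le> e" .
  qed
  finally show "?I \<le> ?J + ennreal e" by (simp add: add_left_mono)
qed

lemma norm_submartingale:
  assumes ij: "i \<le> j" and A: "A \<in> sets (G i)"
  shows "(\<integral>\<^sup>+ x\<in>A. ennreal (norm (h i x)) \<partial>M) \<le> (\<integral>\<^sup>+ x\<in>A. ennreal (norm (h j x)) \<partial>M)"
proof -
  obtain X :: "nat \<Rightarrow> 'a set" where X: "\<And>k. X k \<in> sets (G 0)" "(\<Union>k. X k) = space M"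
    "\<And>k. emeasure M (X k) < \<infinity>" "disjoint_family X" using finite_cover by metis
  have sets: "A \<inter> X k \<in> sets (G i)" for k
    using A X(1)[of k] filtration[of 0 i] by auto
  have [measurable]: "A \<inter> X k \<in> sets M" "A \<in> sets M" for k using sets A by (auto intro: sets_G)
  have "disjoint_family (\<lambda>k. A \<inter> X k)" using X(4) by (auto simp: disjoint_family_on_def)
  moreover have "(\<Union>k. A \<inter> X k) = A" using X(2) sets.sets_into_space[OF A] by auto
  ultimately have split: "(\<integral>\<^sup>+ x\<in>A. u x \<partial>M) = (\<Sum>k. \<integral>\<^sup>+ x\<in>A \<inter> X k. u x \<partial>M)"
    if [measurable]: "u \<in> borel_measurable M" for u :: "'a \<Rightarrow> ennreal"
    using nn_integral_disjoint_family[of u M "\<lambda>k. A \<inter> X k"] by simp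
  have fin: "emeasure M (A \<inter> X k) < \<infinity>" for k
    using emeasure_mono[of "A \<inter> X k" "X k" M] X(3)[of k] sets_G[OF X(1)]
    by (auto intro: le_less_trans)
  have "(\<Sum>k. \<integral>\<^sup>+ x\<in>A \<inter> X k. ennreal (norm (h i x)) \<partial>M) \<le>
      (\<Sum>k. \<integral>\<^sup>+ x\<in>A \<inter> X k. ennreal (norm (h j x)) \<partial>M)"
    by (intro suminf_le norm_submartingale_finite ij sets fin) auto
  then show ?thesis
    using split[of "\<lambda>x. ennreal (norm (h i x))"] split[of "\<lambda>x. ennreal (norm (h j x))"] by simp
qed

lemma weighted_norm_submartingale:
  assumes ij: "i \<le> j" and w: "w \<in> borel_measurable (G i)"
  shows "(\<integral>\<^sup>+ x. w x * ennreal (norm (h i x)) \<partial>M) \<le> (\<integral>\<^sup>+ x. w x * ennreal (norm (h j x)) \<partial>M)"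
  using w
proof (induction rule: borel_measurable_induct)
  case (cong f g)
  have "(\<integral>\<^sup>+ x. g x * ennreal (norm (h k x)) \<partial>M) = (\<integral>\<^sup>+ x. f x * ennreal (norm (h k x)) \<partial>M)" for k
    using cong(3) by (intro nn_integral_cong) auto
  then show ?case using cong(4) by simp
next
  case (set A)
  then show ?case using norm_submartingale[OF ij set] by (simp add: mult.commute)
next
  case (mult u c)
  note [measurable] = measurable_G_imp_M[OF mult(2)]
  show ?case using mult by (simp add: mult.assoc nn_integral_cmult mult_left_mono)
next
  case (add u v)
  note [measurable] = measurable_G_imp_M[OF add(1)] measurable_G_imp_M[OF add(3)]
  show ?case using add by (simp add: distrib_right nn_integral_add add_mono)
next
  case (seq U)
  note [measurable] = measurable_G_imp_M[OF seq(1)]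
  have "(\<integral>\<^sup>+ x. (SUP n. U n) x * ennreal (norm (h k x)) \<partial>M) =
      (SUP n. \<integral>\<^sup>+ x. U n x * ennreal (norm (h k x)) \<partial>M)" for k
    unfolding SUP_apply SUP_mult_right_ennreal
    by (rule nn_integral_monotone_convergence_SUP)
       (use seq(3) in \<open>auto simp: incseq_def le_fun_def intro!: mult_right_mono\<close>)
  then show ?case using seq(5) by (auto intro!: SUP_mono)
qed

end

subsection \<open>Doob's maximal inequality\<close>

text \<open>
  The slope inequality for \<open>x powr p\<close> against \<open>x powr (p - 1)\<close>; it is Young's inequality
  for the mixed term \<open>a powr (p - 1) * b\<close>.
\<close>

lemma powr_increment_ge:
  fixes a b p :: real
  assumes "1 < p" "0 \<le> a" "a \<le> b"
  shows "(p - 1) / p * (b powr p - a powr p) \<le> (b powr (p - 1) - a powr (p - 1)) * b"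
proof -
  have "a powr (p - 1) * b \<le> (p - 1) / p * (a powr p) + 1 / p * (b powr p)"
  proof (cases "a = 0")
    case False
    then have ab: "0 < a" "0 < b" using assms by auto
    have "(a powr p) powr ((p - 1) / p) * (b powr p) powr (1 / p)
        \<le> (p - 1) / p * (a powr p) + 1 / p * (b powr p)"
      by (rule Youngs_inequality_0) (use assms ab in \<open>simp_all add: diff_divide_distrib\<close>)
    then show ?thesis using assms ab by (simp add: powr_powr)
  qed (use assms in simp)
  moreover have "b powr (p - 1) * b = b powr p"
    using assms by (metis powr_mult_base mult.commute add.commute diff_add_cancel order_trans)
  moreover have "1 / p * (b powr p) = b powr p - (p - 1) / p * (b powr p)"
    using assms by (simp add: field_simps)
  ultimately show ?thesis by (simp add: algebra_simps)
qed

fun running_max :: "(nat \<Rightarrow> real) \<Rightarrow> nat \<Rightarrow> real" where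
  "running_max u 0 = u 0"
| "running_max u (Suc n) = max (running_max u n) (u (Suc n))"

lemma le_running_max: "i \<le> n \<Longrightarrow> u i \<le> running_max u n"
  by (induction n) (auto simp: le_Suc_eq)

lemma running_max_attained: "\<exists>i\<le>n. running_max u n = u i"
  by (induction n) (auto simp: max_def le_Suc_eq)

lemma running_max_nonneg: "(\<And>i. 0 \<le> u i) \<Longrightarrow> 0 \<le> running_max u n"
  using running_max_attained[of n u] by auto

text \<open>
  Summation by parts over these increments of \<open>S powr q\<close>, where \<open>S\<close> is the running maximum,
  replaces the integral over level sets in the usual proof of Doob's inequality.
\<close>

fun max_increment :: "real \<Rightarrow> (nat \<Rightarrow> real) \<Rightarrow> nat \<Rightarrow> real" where
  "max_increment q u 0 = running_max u 0 powr q"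
| "max_increment q u (Suc n) = running_max u (Suc n) powr q - running_max u n powr q"

lemma max_increment_nonneg:
  assumes "\<And>i. 0 \<le> u i" "0 \<le> q"
  shows "0 \<le> max_increment q u n"
  using assms by (cases n) (auto intro!: powr_mono2 running_max_nonneg)

lemma sum_max_increment: "(\<Sum>i\<le>n. max_increment q u i) = running_max u n powr q"
  by (induction n) auto

text \<open>
  The increment vanishes unless a new maximum is reached, and then the maximum is the
  current value; so each \<open>u i\<close> may be read as the running maximum, and \<open>powr_increment_ge\<close>
  telescopes.
\<close>

lemma running_max_powr_le:
  assumes "1 < p" and u: "\<And>i. 0 \<le> u i"
  shows "(p - 1) / p * running_max u n powr p \<le> (\<Sum>i\<le>n. max_increment (p - 1) u i * u i)"
proof (induction n)
  case 0
  have "u 0 powr (p - 1) * u 0 = u 0 powr p"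
    using u[of 0] by (metis powr_mult_base mult.commute add.commute diff_add_cancel)
  moreover have "(p - 1) / p * u 0 powr p \<le> 1 * u 0 powr p"
    using assms by (intro mult_right_mono) auto
  ultimately show ?case by simp
next
  case (Suc n)
  let ?a = "running_max u n" and ?b = "running_max u (Suc n)"
  have "(p - 1) / p * (?b powr p - ?a powr p) \<le> max_increment (p - 1) u (Suc n) * u (Suc n)"
  proof (cases "?b = ?a")
    case False
    then have "?b = u (Suc n)" by (auto simp: max_def split: if_splits)
    then show ?thesis
      using powr_increment_ge[of p ?a ?b] running_max_nonneg[of u n] assms by simp
  qed simp
  with Suc show ?case by (simp add: algebra_simps)
qed

text \<open>
  A substitute for Hoelder's inequality with a free parameter: compare \<open>b\<close> with \<open>K * a\<close>.
\<close>

lemma mult_powr_le_split: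
  fixes a b p K :: real
  assumes "1 < p" "0 \<le> a" "0 \<le> b" "0 < K"
  shows "b powr (p - 1) * a \<le> K powr (p - 1) * a powr p + b powr p / K"
proof (cases "b \<le> K * a")
  case True
  have "b powr (p - 1) * a \<le> (K * a) powr (p - 1) * a"
    using assms True by (intro mult_right_mono powr_mono2) auto
  also have "\<dots> = K powr (p - 1) * (a powr (p - 1) * a)"
    using assms by (simp add: powr_mult)
  also have "a powr (p - 1) * a = a powr p"
    using assms by (metis powr_mult_base mult.commute add.commute diff_add_cancel)
  finally show ?thesis using assms by (simp add: add_increasing2)
next
  case False
  then have "a \<le> b / K" using assms by (simp add: field_simps)
  then have "b powr (p - 1) * a \<le> b powr (p - 1) * (b / K)"
    by (intro mult_left_mono) auto
  also have "\<dots> = b powr (p - 1) * b / K" by simp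
  also have "b powr (p - 1) * b = b powr p"
    using assms by (metis powr_mult_base mult.commute add.commute diff_add_cancel)
  finally show ?thesis using assms by (simp add: add_increasing)
qed

context adapted_martingale
begin

lemma running_max_measurable:
  "(\<lambda>x. running_max (\<lambda>i. norm (h i x)) n) \<in> borel_measurable (G n)"
proof (induction n)
  case 0
  then show ?case using strongly_measurable_norm[OF adapted] by simp
next
  case (Suc n)
  have "(\<lambda>x. running_max (\<lambda>i. norm (h i x)) n) \<in> borel_measurable (G (Suc n))"
    by (rule measurable_from_subalg[OF _ Suc]) (use filtration[of n "Suc n"] in \<open>auto simp: subalgebra_def\<close>)
  then show ?case using strongly_measurable_norm[OF adapted, of "Suc n"] by simp
qed

lemma max_increment_measurable:
  "(\<lambda>x. max_increment q (\<lambda>i. norm (h i x)) n) \<in> borel_measurable (G n)"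
proof (cases n)
  case 0
  then show ?thesis using running_max_measurable[of 0] by simp
next
  case (Suc m)
  have "(\<lambda>x. running_max (\<lambda>i. norm (h i x)) m) \<in> borel_measurable (G n)"
    by (rule measurable_from_subalg[OF _ running_max_measurable])
       (use filtration[of m n] Suc in \<open>auto simp: subalgebra_def\<close>)
  then show ?thesis using running_max_measurable[of n] unfolding Suc max_increment.simps by measurable
qed

text \<open>
  With \<open>S\<close> the running maximum and \<open>w\<^sub>i\<close> the increments of \<open>S powr (p - 1)\<close>, the sum of the \<open>w\<^sub>i * norm (h i)\<close>
  dominates \<open>(p - 1) / p * S powr p\<close>.  As \<open>w\<^sub>i\<close> is nonnegative and known at time \<open>i\<close>, replacing \<open>h i\<close> by
  the final \<open>h n\<close> only increases the integral, and then the weights add up to \<open>S powr (p - 1)\<close>.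
  Splitting the product with \<open>K = 2 * p / (p - 1)\<close> leaves half of the left-hand side on the right,
  where it can be absorbed because \<open>S powr p\<close> has finite integral.
\<close>

theorem doob_maximal_inequality:
  assumes p: "1 < p"
    and fin: "\<And>i. i \<le> n \<Longrightarrow> (\<integral>\<^sup>+ x. ennreal (norm (h i x) powr p) \<partial>M) < \<infinity>"
  shows "(\<integral>\<^sup>+ x. ennreal (running_max (\<lambda>i. norm (h i x)) n powr p) \<partial>M)
    \<le> ennreal ((2 * p / (p - 1)) powr p) * (\<integral>\<^sup>+ x. ennreal (norm (h n x) powr p) \<partial>M)"
proof -
  define S where "S x = running_max (\<lambda>i. norm (h i x)) n" for x
  define w where "w i x = max_increment (p - 1) (\<lambda>i. norm (h i x)) i" for i x
  define K where "K = 2 * p / (p - 1)"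
  have K: "0 < K" using p by (simp add: K_def)
  have S0: "0 \<le> S x" for x by (simp add: S_def running_max_nonneg)
  have w0: "0 \<le> w i x" for i x using p by (simp add: w_def max_increment_nonneg)
  have [measurable]: "S \<in> borel_measurable M"
    unfolding S_def by (rule measurable_G_imp_M[OF running_max_measurable])
  have wG: "w i \<in> borel_measurable (G i)" for i unfolding w_def by (rule max_increment_measurable)
  note [measurable] = measurable_G_imp_M[OF wG]
  let ?S = "\<integral>\<^sup>+ x. ennreal (S x powr p) \<partial>M" and ?h = "\<integral>\<^sup>+ x. ennreal (norm (h n x) powr p) \<partial>M"
  \<comment> \<open>Finiteness of the left-hand side, required for the absorption at the end.\<close>
  have "?S \<le> (\<integral>\<^sup>+ x. (\<Sum>i\<le>n. ennreal (norm (h i x) powr p)) \<partial>M)"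
  proof (rule nn_integral_mono)
    fix x
    obtain i where "i \<le> n" "S x = norm (h i x)"
      using running_max_attained[of n "\<lambda>i. norm (h i x)"] by (auto simp: S_def)
    then show "ennreal (S x powr p) \<le> (\<Sum>i\<le>n. ennreal (norm (h i x) powr p))"
      by (metis atMost_iff finite_atMost member_le_sum zero_le)
  qed
  also have "\<dots> = (\<Sum>i\<le>n. \<integral>\<^sup>+ x. ennreal (norm (h i x) powr p) \<partial>M)"
    by (rule nn_integral_sum) measurable
  also have "\<dots> < \<infinity>" using fin by simp
  finally have Sfin: "?S < \<infinity>" .
  have "ennreal ((p - 1) / p) * ?S = (\<integral>\<^sup>+ x. ennreal ((p - 1) / p * S x powr p) \<partial>M)"
    using p by (simp add: nn_integral_cmult ennreal_mult del: times_divide_eq_left)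
  also have "\<dots> \<le> (\<integral>\<^sup>+ x. ennreal (\<Sum>i\<le>n. w i x * norm (h i x)) \<partial>M)"
    unfolding S_def w_def by (intro nn_integral_mono ennreal_leI running_max_powr_le p) simp
  also have "\<dots> = (\<integral>\<^sup>+ x. (\<Sum>i\<le>n. ennreal (w i x) * ennreal (norm (h i x))) \<partial>M)"
    using w0 by (intro nn_integral_cong) (simp add: sum_ennreal[symmetric] ennreal_mult)
  also have "\<dots> = (\<Sum>i\<le>n. \<integral>\<^sup>+ x. ennreal (w i x) * ennreal (norm (h i x)) \<partial>M)"
    by (rule nn_integral_sum) measurable
  also have "\<dots> \<le> (\<Sum>i\<le>n. \<integral>\<^sup>+ x. ennreal (w i x) * ennreal (norm (h n x)) \<partial>M)"
    using wG by (intro sum_mono weighted_norm_submartingale) auto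
  also have "\<dots> = (\<integral>\<^sup>+ x. (\<Sum>i\<le>n. ennreal (w i x) * ennreal (norm (h n x))) \<partial>M)"
    by (rule nn_integral_sum[symmetric]) measurable
  also have "\<dots> = (\<integral>\<^sup>+ x. ennreal (S x powr (p - 1) * norm (h n x)) \<partial>M)"
    using w0 unfolding S_def sum_max_increment[symmetric]
    by (intro nn_integral_cong)
       (simp add: w_def[symmetric] sum_ennreal ennreal_mult sum_nonneg flip: sum_distrib_right)
  also have "\<dots> \<le> (\<integral>\<^sup>+ x. ennreal (K powr (p - 1)) * ennreal (norm (h n x) powr p) +
      ennreal (1 / K) * ennreal (S x powr p) \<partial>M)"
  proof (rule nn_integral_mono)
    fix x
    have "S x powr (p - 1) * norm (h n x) \<le> K powr (p - 1) * norm (h n x) powr p + 1 / K * S x powr p"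
      using mult_powr_le_split[OF p _ S0 K, of "norm (h n x)" x] by simp
    then show "ennreal (S x powr (p - 1) * norm (h n x)) \<le>
        ennreal (K powr (p - 1)) * ennreal (norm (h n x) powr p) + ennreal (1 / K) * ennreal (S x powr p)"
      using K by (simp flip: ennreal_mult ennreal_plus add: ennreal_leI)
  qed
  also have "\<dots> = ennreal (K powr (p - 1)) * ?h + ennreal (1 / K) * ?S"
    by (simp add: nn_integral_add nn_integral_cmult)
  finally have main: "ennreal ((p - 1) / p) * ?S \<le> ennreal (K powr (p - 1)) * ?h + ennreal (1 / K) * ?S" .
  have hfin: "?h < \<infinity>" by (rule fin) simp
  obtain s where s: "?S = ennreal s" "0 \<le> s" using Sfin by (cases ?S) auto
  obtain t where t: "?h = ennreal t" "0 \<le> t" using hfin by (cases ?h) auto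
  note st = s(1) t(1) s(2) t(2)
  have "(p - 1) / p * s \<le> K powr (p - 1) * t + 1 / K * s"
    using main st p K by (simp flip: ennreal_mult ennreal_plus)
  moreover have "(p - 1) / p = 2 * (1 / K)" using p by (simp add: K_def field_simps)
  ultimately have "1 / K * s \<le> K powr (p - 1) * t" by simp
  then have "s \<le> K * (K powr (p - 1)) * t" using K by (simp add: field_simps)
  also have "K * (K powr (p - 1)) = K powr p" using K powr_mult_base[of K "p - 1"] by simp
  finally have "s \<le> K powr p * t" .
  then show ?thesis
    unfolding S_def[symmetric] K_def[symmetric] st using st(4) by (simp add: ennreal_leI flip: ennreal_mult)
qed

end


section \<open>Extended powers and norms\<close>

lemma epowr_ennreal [simp]: "0 \<le> r \<Longrightarrow> epowr (ennreal r) a = ennreal (r powr a)"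
  by (simp add: epowr_def)

lemma epowr_top [simp]: "epowr \<top> a = \<top>"
  by (simp add: epowr_def)

lemma epowr_mono: "0 \<le> a \<Longrightarrow> x \<le> y \<Longrightarrow> epowr x a \<le> epowr y a"
  by (cases x; cases y) (auto simp: ennreal_leI powr_mono2 top_unique)

lemma epowr_mult:
  assumes "0 < a"
  shows "epowr (x * y) a = epowr x a * epowr y a"
proof -
  have top: "epowr (\<top> * z) a = \<top> * epowr z a" for z
    by (cases z) (auto simp: ennreal_top_mult epowr_def assms)
  show ?thesis
  proof (cases "x = \<top> \<or> y = \<top>")
    case True
    then show ?thesis
      using top[of x] top[of y] by (metis epowr_top mult.commute)
  next
    case False
    then obtain r s where rs: "x = ennreal r" "y = ennreal s" "0 \<le> r" "0 \<le> s"
      by (metis ennreal_cases)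
    then have "epowr (x * y) a = epowr (ennreal (r * s)) a" by (simp add: ennreal_mult)
    also have "\<dots> = ennreal (r powr a * s powr a)" using rs by (simp add: powr_mult)
    also have "\<dots> = epowr x a * epowr y a" using rs by (simp add: ennreal_mult)
    finally show ?thesis .
  qed
qed

lemma epowr_epowr_inverse: "0 < a \<Longrightarrow> epowr (epowr x a) (1 / a) = x"
  by (cases x) (auto simp: powr_powr)

lemma epowr_less_top: "epowr x a < \<top> \<longleftrightarrow> x < \<top>"
  by (cases x) auto

lemma epowr_measurable [measurable (raw)]:
  assumes [measurable]: "f \<in> borel_measurable M"
  shows "(\<lambda>x. epowr (f x) a) \<in> borel_measurable M"
  unfolding epowr_def by measurable

lemma Lp_norm_mono_AE:
  assumes "0 < p" "AE x in M. f x \<le> g x"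
  shows "Lp_norm p M f \<le> Lp_norm p M g"
proof -
  have "AE x in M. epowr (f x) p \<le> epowr (g x) p"
    using assms(2) by eventually_elim (use assms(1) in \<open>auto intro: epowr_mono\<close>)
  then show ?thesis
    unfolding Lp_norm_def using assms(1) by (intro epowr_mono nn_integral_mono_AE) auto
qed

lemma Lp_norm_mono: "0 < p \<Longrightarrow> (\<And>x. x \<in> space M \<Longrightarrow> f x \<le> g x) \<Longrightarrow> Lp_norm p M f \<le> Lp_norm p M g"
  by (rule Lp_norm_mono_AE) auto

lemma Lp_norm_cong_AE: "0 < p \<Longrightarrow> AE x in M. f x = g x \<Longrightarrow> Lp_norm p M f = Lp_norm p M g"
  by (intro antisym Lp_norm_mono_AE) auto

lemma Lp_norm_cmult:
  assumes "0 < p" and [measurable]: "f \<in> borel_measurable M"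
  shows "Lp_norm p M (\<lambda>x. c * f x) = c * Lp_norm p M f"
  using assms by (simp add: Lp_norm_def epowr_mult nn_integral_cmult epowr_epowr_inverse)

section \<open>Greedy jump times\<close>

text \<open>
  The path is observed up to time \<open>n\<close>; if no jump is left, the next time is \<open>n\<close>, so that the
  sequence of times is defined for ever and the sampled path is finally constant.
\<close>

definition next_jump :: "real \<Rightarrow> nat \<Rightarrow> (nat \<Rightarrow> 'b::real_normed_vector) \<Rightarrow> nat \<Rightarrow> nat" where
  "next_jump r n g l =
     (if \<exists>m. l < m \<and> m \<le> n \<and> r \<le> norm (g m - g l)
      then LEAST m. l < m \<and> r \<le> norm (g m - g l) else n)"

primrec jump_time :: "real \<Rightarrow> nat \<Rightarrow> (nat \<Rightarrow> 'b::real_normed_vector) \<Rightarrow> nat \<Rightarrow> nat" where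
  "jump_time r n g 0 = 0"
| "jump_time r n g (Suc j) = next_jump r n g (jump_time r n g j)"

lemma next_jump_first:
  assumes "l < m" "m \<le> n" "r \<le> norm (g m - g l)"
  shows "l < next_jump r n g l" "next_jump r n g l \<le> m"
    "r \<le> norm (g (next_jump r n g l) - g l)"
proof -
  have eq: "next_jump r n g l = (LEAST m. l < m \<and> r \<le> norm (g m - g l))"
    using assms unfolding next_jump_def by auto
  have "l < (LEAST m. l < m \<and> r \<le> norm (g m - g l)) \<and>
      r \<le> norm (g (LEAST m. l < m \<and> r \<le> norm (g m - g l)) - g l)"
    by (rule LeastI[of "\<lambda>m. l < m \<and> r \<le> norm (g m - g l)" m]) (use assms in auto)
  then show "l < next_jump r n g l" "r \<le> norm (g (next_jump r n g l) - g l)" by (simp_all add: eq)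
  show "next_jump r n g l \<le> m" unfolding eq by (rule Least_le) (use assms in auto)
qed

lemma next_jump_bounds: "next_jump r n g l \<le> n" "l \<le> n \<Longrightarrow> l \<le> next_jump r n g l"
proof -
  have "next_jump r n g l \<le> n \<and> (l \<le> n \<longrightarrow> l \<le> next_jump r n g l)"
  proof (cases "\<exists>m. l < m \<and> m \<le> n \<and> r \<le> norm (g m - g l)")
    case True
    then show ?thesis using next_jump_first[of l _ n r g] by (meson less_imp_le order_trans)
  next
    case False
    then have "next_jump r n g l = n" unfolding next_jump_def by (rule if_not_P)
    then show ?thesis by simp
  qed
  then show "next_jump r n g l \<le> n" "l \<le> n \<Longrightarrow> l \<le> next_jump r n g l" by auto
qed

text \<open>
  Whether the next jump is at \<open>m < n\<close> is decided by the path up to time \<open>m\<close>.  For \<open>m = n\<close> the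
  default value interferes, and that case is treated as a complement.
\<close>

lemma next_jump_eq_iff:
  assumes "m < n"
  shows "next_jump r n g l = m \<longleftrightarrow>
    l < m \<and> r \<le> norm (g m - g l) \<and> (\<forall>q\<in>{l<..<m}. norm (g q - g l) < r)"
proof
  assume eq: "next_jump r n g l = m"
  then have "\<exists>m. l < m \<and> m \<le> n \<and> r \<le> norm (g m - g l)"
    using assms by (metis next_jump_def less_irrefl)
  then have "l < m" "r \<le> norm (g m - g l)" using next_jump_first[of l _ n r g] eq by blast+
  moreover have "norm (g q - g l) < r" if "q \<in> {l<..<m}" for q
  proof (rule ccontr)
    assume "\<not> norm (g q - g l) < r"
    then have "next_jump r n g l \<le> q" using that assms by (intro next_jump_first) auto
    then show False using eq that by simp
  qed
  ultimately show "l < m \<and> r \<le> norm (g m - g l) \<and> (\<forall>q\<in>{l<..<m}. norm (g q - g l) < r)" by blast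
next
  assume *: "l < m \<and> r \<le> norm (g m - g l) \<and> (\<forall>q\<in>{l<..<m}. norm (g q - g l) < r)"
  with assms have "l < next_jump r n g l" "next_jump r n g l \<le> m"
    "r \<le> norm (g (next_jump r n g l) - g l)" using next_jump_first[of l m n r g] by auto
  with * show "next_jump r n g l = m"
    by (metis greaterThanLessThan_iff leD le_neq_implies_less)
qed

lemma jump_time_le: "jump_time r n g j \<le> n"
  by (cases j) (simp_all add: next_jump_bounds)

lemma jump_time_mono: "i \<le> j \<Longrightarrow> jump_time r n g i \<le> jump_time r n g j"
  by (rule lift_Suc_mono_le[of "jump_time r n g"]) (simp_all add: next_jump_bounds jump_time_le)

text \<open>
  If \<open>\<tau>\<^sub>j \<le> t\<^sub>j\<close>, then one of \<open>t\<^sub>j\<close> and \<open>t\<^sub>j\<^sub>+\<^sub>1\<close> is a jump of size \<open>l / 2\<close> seen from \<open>\<tau>\<^sub>j\<close>, since their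
  values are \<open>l\<close> apart.  Hence the next greedy time is a genuine jump and comes no later than \<open>t\<^sub>j\<^sub>+\<^sub>1\<close>,
  and the induction goes on.
\<close>

lemma jump_time_is_jump:
  fixes g :: "nat \<Rightarrow> 'b::real_normed_vector"
  assumes "0 < l" and tn: "\<And>j. j \<le> J \<Longrightarrow> t j \<le> n" and inc: "\<And>j. j < J \<Longrightarrow> t j < t (Suc j)"
    and jump: "\<And>j. j < J \<Longrightarrow> l \<le> norm (g (t (Suc j)) - g (t j))"
    and "j < J"
  shows "l / 2 \<le> norm (g (jump_time (l / 2) n g (Suc j)) - g (jump_time (l / 2) n g j))"
proof -
  let ?\<tau> = "jump_time (l / 2) n g"
  have step: "?\<tau> (Suc j) \<le> t (Suc j) \<and> l / 2 \<le> norm (g (?\<tau> (Suc j)) - g (?\<tau> j))"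
    if "j < J" "?\<tau> j \<le> t j" for j
  proof -
    have "norm (g (t (Suc j)) - g (t j)) \<le> norm (g (t (Suc j)) - g (?\<tau> j)) + norm (g (t j) - g (?\<tau> j))"
      using norm_triangle_ineq4[of "g (t (Suc j)) - g (?\<tau> j)" "g (t j) - g (?\<tau> j)"] by simp
    with jump[OF \<open>j < J\<close>] consider "l / 2 \<le> norm (g (t (Suc j)) - g (?\<tau> j))"
      | "l / 2 \<le> norm (g (t j) - g (?\<tau> j))" by linarith
    then show ?thesis
    proof cases
      case 1
      then show ?thesis
        using next_jump_first[of "?\<tau> j" "t (Suc j)" n "l / 2" g] that inc[OF \<open>j < J\<close>] tn[of "Suc j"] by simp
    next
      case 2
      then have "?\<tau> j \<noteq> t j" using \<open>0 < l\<close> by auto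
      with 2 show ?thesis
        using next_jump_first[of "?\<tau> j" "t j" n "l / 2" g] that inc[OF \<open>j < J\<close>] tn[of j] by simp
    qed
  qed
  \<comment> \<open>The greedy jump times never fall behind the given chain.\<close>
  have le: "?\<tau> j \<le> t j" if "j \<le> J" for j
    using that by (induction j) (use step in auto)
  show ?thesis using step[of j] le[of j] \<open>j < J\<close> by simp
qed

text \<open>
  Each of the counted jumps contributes at least \<open>(l / 2) powr \<rho>\<close> to the sum that defines \<open>S_rho\<close>.
\<close>

lemma jump_count_le_S_rho:
  fixes g :: "nat \<Rightarrow> 'a \<Rightarrow> 'b::banach"
  assumes "0 < l" "0 < \<rho>"
  shows "ennreal l * epowr (ennreal_of_enat (jump_count l {..n} (\<lambda>i. g i x))) (1 / \<rho>)
    \<le> 2 * S_rho \<rho> (\<lambda>j x. g (jump_time (l / 2) n (\<lambda>i. g i x) j) x) x"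
proof -
  define \<tau> where "\<tau> = jump_time (l / 2) n (\<lambda>i. g i x)"
  define T where "T = (\<Sum>j. ennreal (norm (g (\<tau> (Suc j)) x - g (\<tau> j) x) powr \<rho>))"
  let ?c = "ennreal ((l / 2) powr \<rho>)"
  have chain: "of_nat J * ?c \<le> T"
    if t: "\<forall>j\<le>J. t j \<in> {..n}" "\<forall>j<J. t j < t (Suc j)"
      "\<forall>j. 0 < j \<and> j \<le> J \<longrightarrow> l \<le> norm (g (t j) x - g (t (j - 1)) x)" for J and t :: "nat \<Rightarrow> nat"
  proof -
    have "l \<le> norm (g (t (Suc j)) x - g (t j) x)" if "j < J" for j
      using t(3)[rule_format, of "Suc j"] that by simp
    then have "l / 2 \<le> norm (g (\<tau> (Suc j)) x - g (\<tau> j) x)" if "j < J" for j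
      unfolding \<tau>_def using t that assms
      by (intro jump_time_is_jump[of l J t n "\<lambda>i. g i x" j]) auto
    then have "(\<Sum>j<J. ?c) \<le> (\<Sum>j<J. ennreal (norm (g (\<tau> (Suc j)) x - g (\<tau> j) x) powr \<rho>))"
      using assms by (intro sum_mono ennreal_leI powr_mono2) auto
    also have "\<dots> \<le> T" unfolding T_def by (rule sum_le_suminf) auto
    finally show ?thesis by simp
  qed
  have "ennreal_of_enat (jump_count l {..n} (\<lambda>i. g i x)) * ?c \<le> T"
    unfolding jump_count_def ennreal_of_enat_Sup SUP_mult_right_ennreal
    by (rule SUP_least) (use chain in auto)
  then have "epowr (ennreal_of_enat (jump_count l {..n} (\<lambda>i. g i x)) * ?c) (1 / \<rho>) \<le> epowr T (1 / \<rho>)"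
    using assms by (intro epowr_mono) auto
  moreover have "epowr ?c (1 / \<rho>) = ennreal (l / 2)"
    using assms by (simp add: powr_powr)
  ultimately have "epowr (ennreal_of_enat (jump_count l {..n} (\<lambda>i. g i x))) (1 / \<rho>) * ennreal (l / 2)
      \<le> epowr T (1 / \<rho>)"
    using assms by (simp add: epowr_mult)
  then have "2 * (epowr (ennreal_of_enat (jump_count l {..n} (\<lambda>i. g i x))) (1 / \<rho>) * ennreal (l / 2))
      \<le> 2 * epowr T (1 / \<rho>)"
    by (rule mult_left_mono) simp
  moreover have "2 * ennreal (l / 2) = ennreal l"
    using assms ennreal_mult[of 2 "l / 2"] by simp
  moreover have "2 * (E * ennreal (l / 2)) = 2 * ennreal (l / 2) * E" for E by (simp add: ac_simps)
  ultimately show ?thesis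
    unfolding S_rho_def T_def \<tau>_def by simp
qed

section \<open>Optional stopping\<close>

lemma sigma_finite_subalgebraI:
  assumes sub: "subalgebra M F" and X: "\<And>k::nat. X k \<in> sets F" "(\<Union>k. X k) = space M"
    "\<And>k. emeasure M (X k) < \<infinity>"
  shows "sigma_finite_subalgebra M F"
  unfolding sigma_finite_subalgebra_def
proof (intro conjI sub)
  show "sigma_finite_measure (restr_to_subalg M F)"
  proof (rule sigma_finite_measure.intro)
    show "\<exists>A. countable A \<and> A \<subseteq> sets (restr_to_subalg M F) \<and> \<Union> A = space (restr_to_subalg M F) \<and>
        (\<forall>a\<in>A. emeasure (restr_to_subalg M F) a \<noteq> \<infinity>)"
    proof (intro exI[of _ "range X"] conjI ballI)
      fix a assume "a \<in> range X"
      then obtain k where "a = X k" by blast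
      then show "emeasure (restr_to_subalg M F) a \<noteq> \<infinity>"
        using X(1,3)[of k] by (simp add: emeasure_restr_to_subalg[OF sub])
    qed (use X in \<open>auto simp: sets_restr_to_subalg[OF sub] space_restr_to_subalg\<close>)
  qed
qed

context adapted_martingale
begin

definition stopping :: "('a \<Rightarrow> nat) \<Rightarrow> bool" where
  "stopping \<tau> \<longleftrightarrow> (\<forall>m. {x \<in> space M. \<tau> x = m} \<in> sets (G m))"

definition stopped_algebra :: "('a \<Rightarrow> nat) \<Rightarrow> 'a measure" where
  "stopped_algebra \<tau> =
     sigma (space M) {A \<in> sets M. \<forall>m. A \<inter> {x \<in> space M. \<tau> x = m} \<in> sets (G m)}"

lemma space_stopped_algebra [simp]: "space (stopped_algebra \<tau>) = space M"
  by (simp add: stopped_algebra_def space_measure_of_conv)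

lemma sets_stopped_algebra:
  assumes "stopping \<tau>"
  shows "sets (stopped_algebra \<tau>) = {A \<in> sets M. \<forall>m. A \<inter> {x \<in> space M. \<tau> x = m} \<in> sets (G m)}"
    (is "_ = ?S")
proof -
  let ?T = "\<lambda>m. {x \<in> space M. \<tau> x = m}"
  have compl: "space M - A \<in> ?S" if A: "A \<in> ?S" for A
  proof -
    have "(space M - A) \<inter> ?T m = ?T m - A \<inter> ?T m" for m by auto
    moreover have "?T m - A \<inter> ?T m \<in> sets (G m)" for m
      using A assms by (intro sets.Diff) (auto simp: stopping_def)
    moreover have "space M - A \<in> sets M" using A by (intro sets.Diff) auto
    ultimately show ?thesis by simp
  qed
  have union: "(\<Union>k. A k) \<in> ?S" if A: "range A \<subseteq> ?S" for A :: "nat \<Rightarrow> 'a set"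
  proof -
    have "(\<Union>k. A k) \<inter> ?T m = (\<Union>k. A k \<inter> ?T m)" for m by auto
    moreover have "(\<Union>k. A k \<inter> ?T m) \<in> sets (G m)" for m
      using A by (intro sets.countable_UN) auto
    moreover have "(\<Union>k. A k) \<in> sets M" using A by (intro sets.countable_UN) auto
    ultimately show ?thesis by simp
  qed
  have "?S \<subseteq> Pow (space M)" using sets.sets_into_space by auto
  moreover have "{} \<in> ?S" by simp
  ultimately have "sigma_algebra (space M) ?S"
    unfolding sigma_algebra_iff2 using compl union by (intro conjI ballI allI impI)
  then show ?thesis unfolding stopped_algebra_def by (simp add: sigma_algebra.sets_measure_of_eq)
qed

lemma stopped_algebra_mono:
  assumes s: "stopping \<sigma>" and t: "stopping \<tau>" and le: "\<And>x. \<sigma> x \<le> \<tau> x"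
  shows "sets (stopped_algebra \<sigma>) \<subseteq> sets (stopped_algebra \<tau>)"
proof
  fix A assume A: "A \<in> sets (stopped_algebra \<sigma>)"
  have "A \<inter> {x \<in> space M. \<tau> x = m} \<in> sets (G m)" for m
  proof -
    have "A \<inter> {x \<in> space M. \<tau> x = m} =
        (\<Union>l\<le>m. (A \<inter> {x \<in> space M. \<sigma> x = l}) \<inter> {x \<in> space M. \<tau> x = m})"
      using le by auto
    also have "\<dots> \<in> sets (G m)"
    proof (rule sets.finite_UN, simp, rule sets.Int)
      fix l assume "l \<in> {..m}"
      moreover have "A \<inter> {x \<in> space M. \<sigma> x = l} \<in> sets (G l)"
        using A sets_stopped_algebra[OF s] by blast
      ultimately show "A \<inter> {x \<in> space M. \<sigma> x = l} \<in> sets (G m)"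
        using filtration[of l m] by auto
    qed (use t in \<open>simp_all add: stopping_def\<close>)
    finally show ?thesis .
  qed
  then show "A \<in> sets (stopped_algebra \<tau>)" using A by (simp add: sets_stopped_algebra s t)
qed

lemma initial_algebra_subset:
  assumes "stopping \<tau>" and A: "A \<in> sets (G 0)"
  shows "A \<in> sets (stopped_algebra \<tau>)"
proof -
  have "A \<in> sets (G m)" for m using filtration[of 0 m] A by auto
  then show ?thesis
    using assms by (auto simp: sets_stopped_algebra stopping_def intro: sets_G)
qed

lemma sigma_finite_stopped_algebra:
  assumes "stopping \<tau>"
  shows "sigma_finite_subalgebra M (stopped_algebra \<tau>)"
proof -
  obtain X :: "nat \<Rightarrow> 'a set" where X: "\<And>k. X k \<in> sets (G 0)" "(\<Union>k. X k) = space M"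
    "\<And>k. emeasure M (X k) < \<infinity>" "disjoint_family X" using finite_cover by metis
  show ?thesis
  proof (rule sigma_finite_subalgebraI[of _ _ X])
    show "subalgebra M (stopped_algebra \<tau>)"
      by (auto simp: subalgebra_def sets_stopped_algebra assms)
  qed (use X initial_algebra_subset[OF assms] in auto)
qed

lemma strongly_measurable_stopped:
  assumes t: "stopping \<tau>" and le: "\<And>x. \<tau> x \<le> n"
  shows "strongly_measurable (stopped_algebra \<tau>) (\<lambda>x. h (\<tau> x) x)"
proof -
  let ?T = "\<lambda>m. {x \<in> space M. \<tau> x = m}"
  have "\<forall>m. \<exists>D. countable D \<and> h m ` space M \<subseteq> closure D"
    using strongly_measurable_M by (auto simp: strongly_measurable_iff_separable_range)
  then obtain D where D: "\<And>m. countable (D m)" "\<And>m. h m ` space M \<subseteq> closure (D m)" by metis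
  have "(\<lambda>x. h (\<tau> x) x) ` space M \<subseteq> closure (\<Union>m. D m)"
  proof
    fix y assume "y \<in> (\<lambda>x. h (\<tau> x) x) ` space M"
    then obtain x where "x \<in> space M" "y = h (\<tau> x) x" by blast
    then have "y \<in> closure (D (\<tau> x))" using D(2) by blast
    then show "y \<in> closure (\<Union>m. D m)" using closure_mono[of "D (\<tau> x)" "\<Union>m. D m"] by blast
  qed
  moreover have "countable (\<Union>m. D m)" using D(1) by simp
  moreover have "(\<lambda>x. h (\<tau> x) x) \<in> borel_measurable (stopped_algebra \<tau>)"
  proof (rule measurableI)
    fix U :: "'b set" assume U: "U \<in> sets borel"
    let ?A = "(\<lambda>x. h (\<tau> x) x) -` U \<inter> space M"
    have part: "?A \<inter> ?T m \<in> sets (G m)" for m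
    proof -
      have "?A \<inter> ?T m = (h m -` U \<inter> space (G m)) \<inter> ?T m" by auto
      also have "\<dots> \<in> sets (G m)"
        using measurable_sets[OF strongly_measurable_borel[OF adapted] U] t
        by (auto simp: stopping_def)
      finally show ?thesis .
    qed
    have "?A = (\<Union>m. ?A \<inter> ?T m)" by auto
    also have "\<dots> \<in> sets M" by (intro sets.countable_UN'' sets_G[OF part]) simp
    finally show "(\<lambda>x. h (\<tau> x) x) -` U \<inter> space (stopped_algebra \<tau>) \<in> sets (stopped_algebra \<tau>)"
      using part by (simp add: sets_stopped_algebra[OF t])
  qed simp
  ultimately show ?thesis
    unfolding strongly_measurable_iff_separable_range space_stopped_algebra by blast
qed

text \<open>
  Optional stopping: on the part of \<open>A\<close> where \<open>\<tau> = m\<close>, an event of the \<open>m\<close>-th \<open>\<sigma>\<close>-algebra, \<open>h m\<close> and \<open>h n\<close>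
  have the same integral; then sum over the finitely many \<open>m\<close>.
\<close>

lemma stopped_integral:
  assumes t: "stopping \<tau>" and le: "\<And>x. \<tau> x \<le> n"
    and A: "A \<in> sets (stopped_algebra \<tau>)" and fin: "emeasure M A < \<infinity>"
  shows "\<exists>v. has_set_bochner_integral M A (\<lambda>x. h (\<tau> x) x) v \<and> has_set_bochner_integral M A (h n) v"
proof -
  define B where "B m = A \<inter> {x \<in> space M. \<tau> x = m}" for m
  have B: "B m \<in> sets (G m)" and AM: "A \<in> sets M" for m
    using A by (auto simp: B_def sets_stopped_algebra[OF t])
  have finB: "emeasure M (B m) < \<infinity>" for m
    using emeasure_mono[of "B m" A M] fin AM by (auto simp: B_def intro: le_less_trans)
  have "\<exists>v. \<forall>m\<le>n. has_strong_integral M (\<lambda>x. indicator (B m) x *\<^sub>R h m x) (v m) \<and>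
      has_strong_integral M (\<lambda>x. indicator (B m) x *\<^sub>R h n x) (v m)"
    using same_integrals[OF _ B finB, of _ n] unfolding has_set_bochner_integral_iff by metis
  then obtain v where v: "\<And>m. m \<le> n \<Longrightarrow> has_strong_integral M (\<lambda>x. indicator (B m) x *\<^sub>R h m x) (v m)"
      "\<And>m. m \<le> n \<Longrightarrow> has_strong_integral M (\<lambda>x. indicator (B m) x *\<^sub>R h n x) (v m)"
    by blast
  have sum: "(\<Sum>m\<le>n. indicator (B m) x *\<^sub>R k m) = indicator A x *\<^sub>R k (\<tau> x)" for x and k :: "nat \<Rightarrow> 'b"
  proof -
    have "indicator (B m) x *\<^sub>R k m = (if m = \<tau> x then indicator A x *\<^sub>R k (\<tau> x) else 0)" for m
      using sets.sets_into_space[OF AM] by (auto simp: B_def split: split_indicator)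
    then show ?thesis using le[of x] by simp
  qed
  have "has_strong_integral M (\<lambda>x. \<Sum>m\<le>n. indicator (B m) x *\<^sub>R h m x) (\<Sum>m\<le>n. v m)"
    "has_strong_integral M (\<lambda>x. \<Sum>m\<le>n. indicator (B m) x *\<^sub>R h n x) (\<Sum>m\<le>n. v m)"
    by (rule has_strong_integral_sum, use v in simp)+
  then show ?thesis unfolding sum has_set_bochner_integral_iff by blast
qed

text \<open>
  All the sampled functions have the integral of the same final \<open>h n\<close> over events known when
  they are sampled, so they form a martingale for the increasing algebras.
\<close>

lemma stopped_martingale:
  assumes t: "\<And>j. stopping (\<tau> j)" and le: "\<And>j x. \<tau> j x \<le> n"
    and mono: "\<And>i j x. i \<le> j \<Longrightarrow> \<tau> i x \<le> \<tau> j x"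
  shows "martingale_on M UNIV (\<lambda>j. stopped_algebra (\<tau> j)) (\<lambda>j x. h (\<tau> j x) x)"
proof -
  have sm: "strongly_measurable M (\<lambda>x. h (\<tau> j x) x)" for j
    by (rule strongly_measurable_mono[OF strongly_measurable_stopped[OF t le]])
       (auto simp: sets_stopped_algebra t)
  have "filtration_on M UNIV (\<lambda>j. stopped_algebra (\<tau> j))"
    unfolding filtration_on_def
    using sigma_finite_stopped_algebra[OF t] stopped_algebra_mono[OF t t mono] by blast
  moreover have "(\<lambda>x. h (\<tau> j x) x) \<in> L1_loc M" for j
    unfolding L1_loc_def
  proof (intro CollectI conjI ballI impI sm)
    fix A assume A: "A \<in> sets M" "emeasure M A < \<infinity>"
    have "(\<integral>\<^sup>+ x\<in>A. ennreal (norm (h (\<tau> j x) x)) \<partial>M) \<le>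
        (\<integral>\<^sup>+ x. (\<Sum>m\<le>n. ennreal (norm (h m x)) * indicator A x) \<partial>M)"
      using le[of j]
      by (intro nn_integral_mono member_le_sum[of _ "{..n}" "\<lambda>m. ennreal (norm (h m _)) * indicator A _"]) auto
    also have "\<dots> = (\<Sum>m\<le>n. \<integral>\<^sup>+ x\<in>A. ennreal (norm (h m x)) \<partial>M)"
      using A by (intro nn_integral_sum) auto
    also have "\<dots> < \<infinity>" using locally_integrable[OF A] by simp
    finally show "(\<integral>\<^sup>+ x\<in>A. ennreal (norm (h (\<tau> j x) x)) \<partial>M) < \<infinity>" .
  qed
  moreover have "is_cond_exp M (stopped_algebra (\<tau> i)) (\<lambda>x. h (\<tau> j x) x) (\<lambda>x. h (\<tau> i x) x)"
    if "i \<le> j" for i j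
    unfolding is_cond_exp_def
  proof (intro exI[of _ "\<lambda>x. h (\<tau> i x) x"] conjI ballI impI)
    show "strongly_measurable (stopped_algebra (\<tau> i)) (\<lambda>x. h (\<tau> i x) x)"
      by (rule strongly_measurable_stopped[OF t le])
    fix A assume A: "A \<in> sets (stopped_algebra (\<tau> i))" "emeasure M A < \<infinity>"
    then have A': "A \<in> sets (stopped_algebra (\<tau> j))"
      using stopped_algebra_mono[OF t t mono[OF that]] by blast
    obtain v w where v: "has_set_bochner_integral M A (\<lambda>x. h (\<tau> i x) x) v"
        "has_set_bochner_integral M A (h n) v"
      and w: "has_set_bochner_integral M A (\<lambda>x. h (\<tau> j x) x) w"
        "has_set_bochner_integral M A (h n) w"
      using stopped_integral[OF t le A] stopped_integral[OF t le A' A(2)] by blast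
    have "v = w"
      using v(2) w(2) unfolding has_set_bochner_integral_iff by (rule has_strong_integral_unique)
    then show "\<exists>v. has_set_bochner_integral M A (\<lambda>x. h (\<tau> j x) x) v \<and>
        has_set_bochner_integral M A (\<lambda>x. h (\<tau> i x) x) v"
      using v w by blast
  qed simp
  ultimately show ?thesis unfolding martingale_on_def by blast
qed

lemma jump_sets:
  assumes "q \<le> m" "l \<le> m"
  shows "{x \<in> space M. norm (h q x - h l x) < r} \<in> sets (G m)"
proof -
  note [measurable] = strongly_measurable_norm[OF strongly_measurable_diff[OF
      strongly_measurable_later[OF assms(1)] strongly_measurable_later[OF assms(2)]]]
  have "{x \<in> space (G m). norm (h q x - h l x) < r} \<in> sets (G m)" by measurable
  then show ?thesis by simp
qed

lemma jump_time_stopping: "stopping (\<lambda>x. jump_time r n (\<lambda>i. h i x) j)"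
proof (induction j)
  case 0
  have "{x \<in> space M. (0::nat) = m} = (if m = 0 then space (G m) else {})" for m by auto
  then show ?case unfolding stopping_def jump_time.simps by (metis sets.empty_sets sets.top)
next
  case (Suc j)
  let ?t = "\<lambda>x. jump_time r n (\<lambda>i. h i x) j" and ?u = "\<lambda>x. jump_time r n (\<lambda>i. h i x) (Suc j)"
  define N where "N q l = {x \<in> space M. norm (h q x - h l x) < r}" for q l
  have less: "{x \<in> space M. ?u x = m} \<in> sets (G m)" if "m < n" for m
  proof -
    have "{x \<in> space M. ?u x = m} = (\<Union>l<m. ({x \<in> space M. ?t x = l} - N m l) - (\<Union>q\<in>{l<..<m}. space (G m) - N q l))"
      unfolding N_def jump_time.simps next_jump_eq_iff[OF that] by (auto simp: not_less)
    also have "\<dots> \<in> sets (G m)"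
    proof (intro sets.finite_UN sets.Diff)
      fix l assume "l \<in> {..<m}"
      then have lm: "l \<le> m" by simp
      show "{x \<in> space M. ?t x = l} \<in> sets (G m)"
        using Suc filtration[OF lm] unfolding stopping_def by blast
      show "N m l \<in> sets (G m)" unfolding N_def using lm by (intro jump_sets) simp_all
      show "N q l \<in> sets (G m)" if "q \<in> {l<..<m}" for q
        using that unfolding N_def by (intro jump_sets) auto
    qed (use sets.top[of "G m"] in auto)
    finally show ?thesis .
  qed
  have "{x \<in> space M. ?u x = n} = space (G n) - (\<Union>m<n. {x \<in> space M. ?u x = m})"
    using jump_time_le[of r n _ "Suc j"] by (auto simp del: jump_time.simps simp: le_less)
  also have "\<dots> \<in> sets (G n)"
  proof (intro sets.Diff sets.top sets.finite_UN)
    fix m assume "m \<in> {..<n}"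
    then show "{x \<in> space M. ?u x = m} \<in> sets (G n)"
      using less[of m] filtration[of m n] by auto
  qed simp
  finally have "{x \<in> space M. ?u x = n} \<in> sets (G n)" .
  moreover have "{x \<in> space M. ?u x = m} = {}" if "n < m" for m
    using jump_time_le[of r n _ "Suc j"] that by (auto simp del: jump_time.simps simp flip: not_le)
  ultimately show ?case
    unfolding stopping_def using less by (metis linorder_neqE_nat sets.empty_sets)
qed

text \<open>
  Cotype is only asked for on the measure space at hand, since the sampled martingale lives there
  as well.  If the right-hand side is finite, so are all the \<open>p\<close>-norms, as Doob's inequality demands.
  A positive \<open>C\<close> makes the right-hand side infinite in the other case, for \<open>0 * \<top> = 0\<close>.
\<close>

theorem jump_inequality_if_cotype:
  assumes p: "1 < p" and \<rho>: "0 < \<rho>" and C: "0 < C"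
    and cotype: "\<And>G' f'. martingale_on M UNIV G' f' \<Longrightarrow>
      Lp_norm p M (S_rho \<rho> f') \<le> ennreal C * Lp_norm p M (maximal_fun (f' :: nat \<Rightarrow> 'a \<Rightarrow> 'b))"
  shows "jump_norm p \<rho> M {..n} h
    \<le> ennreal (2 * C * (2 * p / (p - 1))) * (SUP i\<in>{..n}. Lp_norm p M (\<lambda>x. ennreal (norm (h i x))))"
    (is "_ \<le> ennreal (2 * C * ?K) * ?R")
proof (cases "?R = \<top>")
  case True
  have "0 < 2 * C * ?K" using C p by simp
  then have "ennreal (2 * C * ?K) \<noteq> 0" by (simp only: ennreal_eq_0_iff not_le)
  then have "ennreal (2 * C * ?K) * \<top> = \<top>" by (simp only: ennreal_mult_top if_False)
  then show ?thesis unfolding True by simp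
next
  case False
  have K: "0 < ?K" using p by simp
  have norm_eq: "Lp_norm p M (\<lambda>x. ennreal (norm (h i x))) =
      epowr (\<integral>\<^sup>+ x. ennreal (norm (h i x) powr p) \<partial>M) (1 / p)" for i
    by (simp add: Lp_norm_def)
  have fin: "(\<integral>\<^sup>+ x. ennreal (norm (h i x) powr p) \<partial>M) < \<infinity>" if "i \<le> n" for i
  proof -
    have "Lp_norm p M (\<lambda>x. ennreal (norm (h i x))) \<le> ?R" using that by (intro SUP_upper) auto
    also have "?R < \<top>" using False unfolding less_top .
    finally show ?thesis unfolding norm_eq epowr_less_top infinity_ennreal_def .
  qed
  let ?max = "\<lambda>x. running_max (\<lambda>i. norm (h i x)) n"
  have max0: "0 \<le> ?max x" for x by (rule running_max_nonneg) simp
  have "Lp_norm p M (\<lambda>x. ennreal (?max x)) = epowr (\<integral>\<^sup>+ x. ennreal (?max x powr p) \<partial>M) (1 / p)"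
    using max0 by (simp add: Lp_norm_def)
  also have "\<dots> \<le> epowr (ennreal (?K powr p) * (\<integral>\<^sup>+ x. ennreal (norm (h n x) powr p) \<partial>M)) (1 / p)"
    using p by (intro epowr_mono doob_maximal_inequality fin) auto
  also have "\<dots> = ennreal ?K * Lp_norm p M (\<lambda>x. ennreal (norm (h n x)))"
    unfolding norm_eq using p K by (simp add: epowr_mult powr_powr)
  also have "\<dots> \<le> ennreal ?K * ?R" by (intro mult_left_mono SUP_upper) auto
  finally have doob: "Lp_norm p M (\<lambda>x. ennreal (?max x)) \<le> ennreal ?K * ?R" .
  show ?thesis
    unfolding jump_norm_def
  proof (rule SUP_least)
    fix l :: real assume "l \<in> {0<..}"
    then have l: "0 < l" by simp
    define \<tau> where "\<tau> j x = jump_time (l / 2) n (\<lambda>i. h i x) j" for j x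
    define H where "H j x = h (\<tau> j x) x" for j x
    have mart: "martingale_on M UNIV (\<lambda>j. stopped_algebra (\<tau> j)) H"
      unfolding H_def \<tau>_def
      by (rule stopped_martingale) (auto intro: jump_time_stopping jump_time_le jump_time_mono)
    then have H: "strongly_measurable M (H j)" for j by (auto simp: martingale_on_def L1_loc_def)
    have [measurable]: "(\<lambda>x. norm (H (Suc j) x - H j x)) \<in> borel_measurable M" for j
      by (intro strongly_measurable_norm strongly_measurable_diff H)
    have [measurable]: "S_rho \<rho> H \<in> borel_measurable M" unfolding S_rho_def[abs_def] by measurable
    have "maximal_fun H x \<le> ennreal (?max x)" for x
      unfolding maximal_fun_def H_def \<tau>_def
      by (intro SUP_least ennreal_leI le_running_max[where u="\<lambda>i. norm (h i x)"] jump_time_le)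
    then have max: "Lp_norm p M (maximal_fun H) \<le> Lp_norm p M (\<lambda>x. ennreal (?max x))"
      using p by (intro Lp_norm_mono) auto
    have "Lp_norm p M (\<lambda>x. ennreal l * epowr (ennreal_of_enat (jump_count l {..n} (\<lambda>i. h i x))) (1 / \<rho>))
        \<le> Lp_norm p M (\<lambda>x. 2 * S_rho \<rho> H x)"
      using p jump_count_le_S_rho[OF l \<rho>, of n h] unfolding H_def \<tau>_def
      by (intro Lp_norm_mono) auto
    also have "\<dots> = 2 * Lp_norm p M (S_rho \<rho> H)" using p by (intro Lp_norm_cmult) auto
    also have "\<dots> \<le> 2 * (ennreal C * (ennreal ?K * ?R))"
      by (intro mult_left_mono order_trans[OF cotype[OF mart]] order_trans[OF max doob]) simp_all
    also have "\<dots> = ennreal (2 * C * ?K) * ?R"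
      using C K by (simp add: ennreal_mult mult.assoc del: times_divide_eq_right)
    finally show "Lp_norm p M (\<lambda>x. ennreal l * epowr (ennreal_of_enat (jump_count l {..n} (\<lambda>i. h i x))) (1 / \<rho>))
        \<le> ennreal (2 * C * ?K) * ?R" .
  qed
qed

end


section \<open>Reduction to adapted martingales indexed by natural numbers\<close>

lemma jump_count_le_reindex:
  fixes g :: "'i::linorder \<Rightarrow> 'b::banach"
  assumes e: "bij_betw e {..n::nat} I" and mono: "\<And>i j. i \<le> j \<Longrightarrow> e i \<le> e j"
    and eq: "\<And>i. i \<le> n \<Longrightarrow> g (e i) = u i"
  shows "jump_count l I g \<le> jump_count l {..n} u"
  unfolding jump_count_def
proof (rule Sup_subset_mono, rule subsetI)
  fix a assume "a \<in> {enat J | J. \<exists>t :: nat \<Rightarrow> 'i. (\<forall>j\<le>J. t j \<in> I) \<and> (\<forall>j<J. t j < t (Suc j)) \<and>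
     (\<forall>j. 0 < j \<and> j \<le> J \<longrightarrow> l \<le> norm (g (t j) - g (t (j - 1))))}"
  then obtain J and t :: "nat \<Rightarrow> 'i" where a: "a = enat J" and t': "\<forall>j\<le>J. t j \<in> I"
    "\<forall>j<J. t j < t (Suc j)" "\<forall>j. 0 < j \<and> j \<le> J \<longrightarrow> l \<le> norm (g (t j) - g (t (j - 1)))"
    by blast
  then have t: "\<And>j. j \<le> J \<Longrightarrow> t j \<in> I" "\<And>j. j < J \<Longrightarrow> t j < t (Suc j)"
    "\<And>j. 0 < j \<Longrightarrow> j \<le> J \<Longrightarrow> l \<le> norm (g (t j) - g (t (j - 1)))" by blast+
  define s where "s j = inv_into {..n} e (t j)" for j
  have s: "s j \<le> n" "e (s j) = t j" if "j \<le> J" for j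
    using inv_into_into[of "t j" e "{..n}"] f_inv_into_f[of "t j" e "{..n}"] e t(1)[OF that]
    by (auto simp: s_def bij_betw_def)
  have "s j < s (Suc j)" if "j < J" for j
  proof (rule ccontr)
    assume "\<not> s j < s (Suc j)"
    then have "e (s (Suc j)) \<le> e (s j)" by (intro mono) simp
    then show False using s[of j] s[of "Suc j"] t(2)[OF that] that by simp
  qed
  moreover have "l \<le> norm (u (s j) - u (s (j - 1)))" if "0 < j" "j \<le> J" for j
    using t(3)[OF that] s[of j] s[of "j - 1"] eq[of "s j"] eq[of "s (j - 1)"] that by simp
  ultimately show "a \<in> {enat J | J. \<exists>t :: nat \<Rightarrow> nat. (\<forall>j\<le>J. t j \<in> {..n}) \<and> (\<forall>j<J. t j < t (Suc j)) \<and>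
     (\<forall>j. 0 < j \<and> j \<le> J \<longrightarrow> l \<le> norm (u (t j) - u (t (j - 1))))}"
    using s by (intro CollectI exI[of _ J] exI[of _ s] conjI) (auto simp: a)
qed

text \<open>
  The enumeration repeats the last element for ever, so that a finite martingale becomes one
  indexed by all natural numbers.
\<close>

lemma finite_linorder_enumeration:
  fixes I :: "'i::linorder set"
  assumes "finite I" "I \<noteq> {}"
  obtains n and e :: "nat \<Rightarrow> 'i"
  where "bij_betw e {..n} I" "\<And>i j. i \<le> j \<Longrightarrow> e i \<le> e j" "\<And>i. e i \<in> I"
proof -
  define L where "L = sorted_list_of_set I"
  have L: "set L = I" "distinct L" "sorted L" using assms by (simp_all add: L_def)
  then have "L \<noteq> []" using assms by auto
  define n where "n = length L - 1"
  have n: "i \<le> n \<longleftrightarrow> i < length L" for i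
    using \<open>L \<noteq> []\<close> by (cases L) (auto simp: n_def)
  have len: "{..n} = {..<length L}" using n by auto
  define e where "e i = L ! min i n" for i
  have "bij_betw ((!) L) {..n} I"
    unfolding len using bij_betw_nth[OF L(2), of "{..<length L}" I] L(1) by auto
  then have "bij_betw e {..n} I"
    by (subst bij_betw_cong[of _ _ "(!) L"]) (simp_all add: e_def)
  moreover have "e i \<le> e j" if "i \<le> j" for i j
    unfolding e_def using that n[of "min j n"] by (intro sorted_nth_mono[OF L(3)]) auto
  moreover have "e i \<in> I" for i
    unfolding e_def L(1)[symmetric] using n[of "min i n"] by (intro nth_mem) simp
  ultimately show thesis by (rule that)
qed

text \<open>
  The diagonal conditional expectations \<open>f\<^sub>t = E(f\<^sub>t | G\<^sub>t)\<close> provide the adapted versions.  The version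
  \<open>k\<close> that occurs for a pair of times can be a different one, but only on a null set.
\<close>

lemma martingale_adapted_version:
  fixes f :: "'i::linorder \<Rightarrow> 'a \<Rightarrow> 'b::banach"
  assumes mart: "martingale_on M I G f" and mono: "\<And>i j. i \<le> j \<Longrightarrow> e i \<le> e j"
    and eI: "\<And>i::nat. e i \<in> I"
  obtains h where "adapted_martingale M (\<lambda>i. G (e i)) h" "\<And>i. AE x in M. f (e i) x = h i x"
proof -
  have sf: "sigma_finite_subalgebra M (G (e i))" for i
    using mart eI[of i] by (simp add: martingale_on_def filtration_on_def)
  have filt: "sets (G (e i)) \<subseteq> sets (G (e j))" if "i \<le> j" for i j
    using mart eI[of i] eI[of j] mono[OF that] by (simp add: martingale_on_def filtration_on_def)
  have space: "space (G (e i)) = space M" and sub: "sets (G (e i)) \<subseteq> sets M" for i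
    using sf[of i] by (auto simp: sigma_finite_subalgebra_def subalgebra_def)
  have cond: "is_cond_exp M (G (e i)) (f (e j)) (f (e i))" if "i \<le> j" for i j
    using mart eI[of i] eI[of j] mono[OF that] by (simp add: martingale_on_def)
  have "\<forall>i. \<exists>h. strongly_measurable (G (e i)) h \<and> (AE x in M. f (e i) x = h x)"
    using cond[OF order_refl] unfolding is_cond_exp_def by blast
  then obtain h where h: "\<And>i. strongly_measurable (G (e i)) (h i)"
    "\<And>i. AE x in M. f (e i) x = h i x" by metis
  have hM: "strongly_measurable M (h i)" for i
    by (rule strongly_measurable_mono[OF h(1) sub space])
  have "adapted_martingale M (\<lambda>i. G (e i)) h"
  proof (rule adapted_martingale.intro)
    fix i A assume A: "A \<in> sets M" "emeasure M A < \<infinity>"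
    have "(\<integral>\<^sup>+ x\<in>A. ennreal (norm (h i x)) \<partial>M) = (\<integral>\<^sup>+ x\<in>A. ennreal (norm (f (e i) x)) \<partial>M)"
      by (rule nn_integral_cong_AE) (use h(2)[of i] in eventually_elim, simp)
    also have "\<dots> < \<infinity>" using mart eI[of i] A by (simp add: martingale_on_def L1_loc_def)
    finally show "(\<integral>\<^sup>+ x\<in>A. ennreal (norm (h i x)) \<partial>M) < \<infinity>" .
  next
    fix i j :: nat and A
    assume ij: "i \<le> j" and A: "A \<in> sets (G (e i))" "emeasure M A < \<infinity>"
    obtain k where k: "AE x in M. f (e i) x = k x"
      "\<exists>v. has_set_bochner_integral M A (f (e j)) v \<and> has_set_bochner_integral M A k v"
      using cond[OF ij] A unfolding is_cond_exp_def by blast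
    then obtain v where v: "has_strong_integral M (\<lambda>x. indicator A x *\<^sub>R f (e j) x) v"
      "has_strong_integral M (\<lambda>x. indicator A x *\<^sub>R k x) v"
      by (auto simp: has_set_bochner_integral_iff)
    have AM: "A \<in> sets M" using A(1) sub by blast
    have "has_strong_integral M (\<lambda>x. indicator A x *\<^sub>R h j x) v"
      by (rule has_strong_integral_cong_AE[OF v(1) strongly_measurable_indicator[OF hM AM]])
         (use h(2)[of j] in eventually_elim, simp)
    moreover have "has_strong_integral M (\<lambda>x. indicator A x *\<^sub>R h i x) v"
      by (rule has_strong_integral_cong_AE[OF v(2) strongly_measurable_indicator[OF hM AM]])
         (use h(2)[of i] k(1) in eventually_elim, simp)
    ultimately show "\<exists>v. has_set_bochner_integral M A (h i) v \<and> has_set_bochner_integral M A (h j) v"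
      unfolding has_set_bochner_integral_iff by blast
  next
    show "sigma_finite_subalgebra M (G (e i))" for i by (rule sf)
    show "sets (G (e i)) \<subseteq> sets (G (e j))" if "i \<le> j" for i j by (rule filt[OF that])
    show "strongly_measurable (G (e i)) (h i)" for i by (rule h(1))
  qed
  then show thesis using h(2) by (rule that)
qed

lemma jump_norm_le_by_adapted:
  fixes f :: "'i::linorder \<Rightarrow> 'a \<Rightarrow> 'b::banach"
  assumes p: "0 < p" and \<rho>: "0 < \<rho>" and "finite I" and mart: "martingale_on M I G f"
    and bound: "\<And>n G' (h :: nat \<Rightarrow> 'a \<Rightarrow> 'b). adapted_martingale M G' h \<Longrightarrow>
      jump_norm p \<rho> M {..n} h \<le> c * (SUP i\<in>{..n}. Lp_norm p M (\<lambda>x. ennreal (norm (h i x))))"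
  shows "jump_norm p \<rho> M I f \<le> c * (SUP t\<in>I. Lp_norm p M (\<lambda>x. ennreal (norm (f t x))))"
proof (cases "I = {}")
  case True
  have "jump_count l I (\<lambda>t. f t x) = 0" for l x
    unfolding jump_count_def True by (auto simp: bot_enat_def[symmetric] intro!: antisym Sup_least)
  then have "jump_norm p \<rho> M I f = 0"
    using p \<rho> by (simp add: jump_norm_def Lp_norm_def epowr_def)
  then show ?thesis by simp
next
  case False
  obtain n and e :: "nat \<Rightarrow> 'i" where e: "bij_betw e {..n} I"
    "\<And>i j. i \<le> j \<Longrightarrow> e i \<le> e j" "\<And>i. e i \<in> I"
    using finite_linorder_enumeration[OF \<open>finite I\<close> False] by metis
  obtain h where h: "adapted_martingale M (\<lambda>i. G (e i)) h" "\<And>i. AE x in M. f (e i) x = h i x"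
    using martingale_adapted_version[OF mart, of e] e by metis
  have AE_all: "AE x in M. \<forall>i. f (e i) x = h i x" using h(2) by (simp add: AE_all_countable)
  have "jump_norm p \<rho> M I f \<le> jump_norm p \<rho> M {..n} h"
    unfolding jump_norm_def
  proof (intro SUP_mono' Lp_norm_mono_AE p)
    fix l
    show "AE x in M. ennreal l * epowr (ennreal_of_enat (jump_count l I (\<lambda>t. f t x))) (1 / \<rho>)
        \<le> ennreal l * epowr (ennreal_of_enat (jump_count l {..n} (\<lambda>i. h i x))) (1 / \<rho>)"
      using AE_all
    proof eventually_elim
      case (elim x)
      have "jump_count l I (\<lambda>t. f t x) \<le> jump_count l {..n} (\<lambda>i. h i x)"
        by (rule jump_count_le_reindex[OF e(1,2)]) (use elim in auto)
      then show ?case using \<rho> by (intro mult_left_mono epowr_mono) auto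
    qed
  qed
  also have "\<dots> \<le> c * (SUP i\<in>{..n}. Lp_norm p M (\<lambda>x. ennreal (norm (h i x))))"
    by (rule bound[OF h(1)])
  also have "\<dots> \<le> c * (SUP t\<in>I. Lp_norm p M (\<lambda>x. ennreal (norm (f t x))))"
  proof (intro mult_left_mono SUP_least)
    fix i
    have "AE x in M. ennreal (norm (h i x)) = ennreal (norm (f (e i) x))"
      using h(2)[of i] by eventually_elim simp
    then have "Lp_norm p M (\<lambda>x. ennreal (norm (h i x))) = Lp_norm p M (\<lambda>x. ennreal (norm (f (e i) x)))"
      by (rule Lp_norm_cong_AE[OF p])
    then show "Lp_norm p M (\<lambda>x. ennreal (norm (h i x))) \<le> (SUP t\<in>I. Lp_norm p M (\<lambda>x. ennreal (norm (f t x))))"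
      using e(3)[of i] by (auto intro: SUP_upper)
  qed simp
  finally show ?thesis .
qed

section \<open>Transfer to path space\<close>

text \<open>
  The largest \<open>\<sigma>\<close>-algebra on the image for which \<open>\<phi>\<close> is measurable.  A function on the image is
  measurable exactly if its composition with \<open>\<phi>\<close> is; so measurability questions on path space
  are settled on the original space.
\<close>

definition image_algebra :: "('a \<Rightarrow> 'c) \<Rightarrow> 'a measure \<Rightarrow> 'c measure" where
  "image_algebra \<phi> F =
     sigma (\<phi> ` space F) {A. A \<subseteq> \<phi> ` space F \<and> \<phi> -` A \<inter> space F \<in> sets F}"

lemma space_image_algebra [simp]: "space (image_algebra \<phi> F) = \<phi> ` space F"
  by (simp add: image_algebra_def space_measure_of_conv)

lemma sets_image_algebra:
  "sets (image_algebra \<phi> F) = {A. A \<subseteq> \<phi> ` space F \<and> \<phi> -` A \<inter> space F \<in> sets F}" (is "_ = ?S")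
proof -
  have compl: "\<phi> ` space F - A \<in> ?S" if "A \<in> ?S" for A
  proof -
    have "\<phi> -` (\<phi> ` space F - A) \<inter> space F = space F - (\<phi> -` A \<inter> space F)" by auto
    then show ?thesis using that by auto
  qed
  have union: "(\<Union>k. A k) \<in> ?S" if A: "range A \<subseteq> ?S" for A :: "nat \<Rightarrow> _"
  proof -
    have "\<phi> -` (\<Union>k. A k) \<inter> space F = (\<Union>k. \<phi> -` A k \<inter> space F)" by auto
    moreover have "(\<Union>k. \<phi> -` A k \<inter> space F) \<in> sets F"
      using A by (intro sets.countable_UN'') auto
    ultimately show ?thesis using A by auto
  qed
  have "sigma_algebra (\<phi> ` space F) ?S"
    unfolding sigma_algebra_iff2 using compl union by (intro conjI ballI allI impI) auto
  then show ?thesis unfolding image_algebra_def by (simp add: sigma_algebra.sets_measure_of_eq)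
qed

lemma measurable_into_image_algebra: "\<phi> \<in> measurable F (image_algebra \<phi> F)"
  by (rule measurableI) (auto simp: sets_image_algebra)

lemma measurable_from_image_algebra:
  assumes "(\<lambda>x. g (\<phi> x)) \<in> measurable F N"
  shows "g \<in> measurable (image_algebra \<phi> F) N"
proof (rule measurableI)
  show "g y \<in> space N" if "y \<in> space (image_algebra \<phi> F)" for y
    using that measurable_space[OF assms] by auto
  fix A assume "A \<in> sets N"
  then have "(\<lambda>x. g (\<phi> x)) -` A \<inter> space F \<in> sets F" by (rule measurable_sets[OF assms])
  moreover have "\<phi> -` (g -` A \<inter> \<phi> ` space F) \<inter> space F = (\<lambda>x. g (\<phi> x)) -` A \<inter> space F" by auto
  ultimately show "g -` A \<inter> space (image_algebra \<phi> F) \<in> sets (image_algebra \<phi> F)"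
    by (simp add: sets_image_algebra)
qed

lemma strongly_measurable_from_image_algebra:
  assumes "strongly_measurable F (\<lambda>x. g (\<phi> x))"
  shows "strongly_measurable (image_algebra \<phi> F) g"
proof -
  obtain D where "countable D" "(\<lambda>x. g (\<phi> x)) ` space F \<subseteq> closure D"
    using assms by (auto simp: strongly_measurable_iff_separable_range)
  moreover have "g ` space (image_algebra \<phi> F) = (\<lambda>x. g (\<phi> x)) ` space F" by auto
  ultimately show ?thesis
    using measurable_from_image_algebra[where g=g and \<phi>=\<phi>, OF strongly_measurable_borel[OF assms]]
    unfolding strongly_measurable_iff_separable_range by auto
qed

context adapted_martingale
begin

text \<open>
  There are only finitely many chains of a given length in \<open>{..n}\<close>.
\<close>

lemma jump_count_measurable:
  "(\<lambda>x. ennreal_of_enat (jump_count l {..n} (\<lambda>i. h i x))) \<in> borel_measurable M"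
proof -
  \<comment> \<open>Chains are taken extensional on \<open>{..J}\<close>, which makes their set finite.\<close>
  define T where "T J = {t \<in> {..J} \<rightarrow>\<^sub>E {..n}. \<forall>j<J. t j < t (Suc j)}" for J
  define A where "A J = (\<Union>t\<in>T J. space M - (\<Union>j\<in>{0<..J}. {x \<in> space M. norm (h (t j) x - h (t (j - 1)) x) < l}))" for J
  have "finite (T J)" for J
    unfolding T_def by (rule finite_subset[OF _ finite_PiE[of "{..J}" "\<lambda>_. {..n}"]]) auto
  moreover have "{x \<in> space M. norm (h q x - h m x) < l} \<in> sets M" for q m
    by (rule sets_G[OF jump_sets[of q "max q m" m]]) auto
  ultimately have [measurable]: "A J \<in> sets M" for J
    unfolding A_def by (intro sets.finite_UN sets.Diff sets.top) auto
  have chain: "x \<in> A J \<longleftrightarrow> (\<exists>t. (\<forall>j\<le>J. t j \<in> {..n}) \<and> (\<forall>j<J. t j < t (Suc j)) \<and>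
     (\<forall>j. 0 < j \<and> j \<le> J \<longrightarrow> l \<le> norm (h (t j) x - h (t (j - 1)) x)))" if x: "x \<in> space M" for x J
  proof
    assume "x \<in> A J"
    then obtain t where "t \<in> T J" "\<And>j. j \<in> {0<..J} \<Longrightarrow> l \<le> norm (h (t j) x - h (t (j - 1)) x)"
      using x by (auto simp: A_def not_less)
    then show "\<exists>t. (\<forall>j\<le>J. t j \<in> {..n}) \<and> (\<forall>j<J. t j < t (Suc j)) \<and>
        (\<forall>j. 0 < j \<and> j \<le> J \<longrightarrow> l \<le> norm (h (t j) x - h (t (j - 1)) x))"
      by (intro exI[of _ t]) (auto simp: T_def PiE_def Pi_def)
  next
    assume "\<exists>t. (\<forall>j\<le>J. t j \<in> {..n}) \<and> (\<forall>j<J. t j < t (Suc j)) \<and>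
        (\<forall>j. 0 < j \<and> j \<le> J \<longrightarrow> l \<le> norm (h (t j) x - h (t (j - 1)) x))"
    then obtain t where t: "\<forall>j\<le>J. t j \<in> {..n}" "\<forall>j<J. t j < t (Suc j)"
        "\<forall>j. 0 < j \<and> j \<le> J \<longrightarrow> l \<le> norm (h (t j) x - h (t (j - 1)) x)" by blast
    then have "restrict t {..J} \<in> T J" by (auto simp: T_def)
    then show "x \<in> A J"
      using x t(3) unfolding A_def by (intro UN_I[of "restrict t {..J}"]) (auto simp: not_less)
  qed
  have "ennreal_of_enat (jump_count l {..n} (\<lambda>i. h i x)) = (SUP J. of_nat J * indicator (A J) x)"
    if x: "x \<in> space M" for x
    unfolding jump_count_def ennreal_of_enat_Sup chain[OF x, symmetric]
  proof (rule antisym)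
    show "(SUP y\<in>{enat J | J. x \<in> A J}. ennreal_of_enat y) \<le> (SUP J. of_nat J * indicator (A J) x)"
    proof (rule SUP_least, clarify)
      fix J assume "x \<in> A J"
      then show "ennreal_of_enat (enat J) \<le> (SUP J. of_nat J * indicator (A J) x)"
        by (intro SUP_upper2[of J]) auto
    qed
    show "(SUP J. of_nat J * indicator (A J) x) \<le> (SUP y\<in>{enat J | J. x \<in> A J}. ennreal_of_enat y)"
    proof (rule SUP_least)
      fix J
      show "of_nat J * indicator (A J) x \<le> (SUP y\<in>{enat J | J. x \<in> A J}. ennreal_of_enat y)"
        by (cases "x \<in> A J") (auto intro!: SUP_upper2[of "enat J"])
    qed
  qed
  then have "(\<lambda>x. ennreal_of_enat (jump_count l {..n} (\<lambda>i. h i x))) \<in> borel_measurable M \<longleftrightarrow>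
      (\<lambda>x. SUP J. of_nat J * (indicator (A J) x :: ennreal)) \<in> borel_measurable M"
    by (intro measurable_cong)
  also have "\<dots>" by measurable
  finally show ?thesis .
qed

text \<open>
  The second component of \<open>\<phi>\<close> records the path, so the coordinates reproduce the martingale.  The
  first one records the cell of \<open>x\<close> in a cover from the first \<open>\<sigma>\<close>-algebra by sets of finite measure;
  the cells become events of the image, and the image filtration is \<open>\<sigma>\<close>-finite.
\<close>

lemma path_space_martingale:
  obtains \<phi> :: "'a \<Rightarrow> 'b path_space" and G' where
    "\<phi> \<in> measurable M (image_algebra \<phi> M)" "\<And>i x. snd (\<phi> x) i = h i x"
    "sigma_finite_measure (distr M (image_algebra \<phi> M) \<phi>)"
    "martingale_on (distr M (image_algebra \<phi> M) \<phi>) UNIV G' (\<lambda>i y. snd y i)"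
proof -
  obtain X :: "nat \<Rightarrow> 'a set" where X: "\<And>k. X k \<in> sets (G 0)" "(\<Union>k. X k) = space M"
    "\<And>k. emeasure M (X k) < \<infinity>" "disjoint_family X" using finite_cover by metis
  define cell where "cell x = (LEAST k. x \<in> X k)" for x
  have cell: "cell x = k \<longleftrightarrow> x \<in> X k" if "x \<in> space M" for x k
  proof -
    have "\<exists>k. x \<in> X k" using X(2) that by auto
    then have "x \<in> X (cell x)" unfolding cell_def by (rule LeastI_ex)
    then show ?thesis using X(4) by (auto simp: disjoint_family_on_def)
  qed
  define \<phi> :: "'a \<Rightarrow> 'b path_space" where "\<phi> x = (cell x, \<lambda>i. h i x)" for x
  define N where "N = image_algebra \<phi> M"
  define M' where "M' = distr M N \<phi>"
  define G' where "G' i = image_algebra \<phi> (G i)" for i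
  have \<phi> [measurable]: "\<phi> \<in> measurable M N" unfolding N_def by (rule measurable_into_image_algebra)
  have sets_M': "sets M' = sets N" and space_M': "space M' = \<phi> ` space M"
    by (auto simp: M'_def N_def)
  have sets_sub: "sets (G' i) \<subseteq> sets M'" for i
    by (auto simp: G'_def sets_M' N_def sets_image_algebra intro: sets_G)
  have em: "emeasure M' A = emeasure M (\<phi> -` A \<inter> space M)" if "A \<in> sets M'" for A
    using that by (simp add: M'_def emeasure_distr sets_M')
  have sf: "sigma_finite_subalgebra M' (G' i)" for i
  proof (rule sigma_finite_subalgebraI[where X="\<lambda>k. {y \<in> \<phi> ` space M. fst y = k}"])
    show "subalgebra M' (G' i)"
      using sets_sub[of i] by (simp add: subalgebra_def space_M' G'_def)
    have pre: "\<phi> -` {y \<in> \<phi> ` space M. fst y = k} \<inter> space M = X k" for k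
    proof -
      have "X k \<subseteq> space M" using X(2) by blast
      then show ?thesis using cell[of _ k] by (auto simp: \<phi>_def)
    qed
    show in_G': "{y \<in> \<phi> ` space M. fst y = k} \<in> sets (G' i)" for k
      using X(1)[of k] filtration[of 0 i] pre[of k] by (auto simp: G'_def sets_image_algebra)
    show "emeasure M' {y \<in> \<phi> ` space M. fst y = k} < \<infinity>" for k
    proof -
      have "{y \<in> \<phi> ` space M. fst y = k} \<in> sets M'" using in_G'[of k] sets_sub[of i] by blast
      then show ?thesis using em pre X(3)[of k] by simp
    qed
    show "(\<Union>k. {y \<in> \<phi> ` space M. fst y = k}) = space M'" by (auto simp: space_M')
  qed
  have coord: "snd (\<phi> x) i = h i x" for i x by (simp add: \<phi>_def)
  have smG': "strongly_measurable (G' i) (\<lambda>y. snd y i)" for i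
    unfolding G'_def by (rule strongly_measurable_from_image_algebra) (simp add: coord adapted)
  have smM': "strongly_measurable M' (\<lambda>y. snd y i)" for i
    by (rule strongly_measurable_mono[OF smG' sets_sub]) (simp add: G'_def space_M')
  have smN: "strongly_measurable N (\<lambda>y. snd y i)" for i
    by (rule strongly_measurable_mono[OF smM']) (simp_all add: sets_M' space_M', simp add: N_def)
  have transfer: "has_set_bochner_integral M' A (\<lambda>y. snd y i) v"
    if A: "A \<in> sets M'" and fin: "emeasure M' A < \<infinity>"
      and v: "has_set_bochner_integral M (\<phi> -` A \<inter> space M) (h i) v" for A i v
  proof -
    have AN: "A \<in> sets N" using A by (simp add: sets_M')
    have B: "\<phi> -` A \<inter> space M \<in> sets M" using measurable_sets[OF \<phi> AN] .
    have ind: "indicator (\<phi> -` A \<inter> space M) x = (indicator A (\<phi> x) :: 'c::zero_neq_one)" if "x \<in> space M" for x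
      using that by (simp add: indicator_def)
    have sm: "strongly_measurable N (\<lambda>y. indicator A y *\<^sub>R snd y i)"
      by (rule strongly_measurable_indicator[OF smN AN])
    have "strongly_measurable M (\<lambda>x. indicator (\<phi> -` A \<inter> space M) x *\<^sub>R h i x)"
      by (rule strongly_measurable_indicator[OF strongly_measurable_M B])
    then have "strongly_measurable M (\<lambda>x. indicator A (\<phi> x) *\<^sub>R snd (\<phi> x) i)"
      unfolding strongly_measurable_def by (simp add: ind coord)
    then have "has_strong_integral M (\<lambda>x. indicator A (\<phi> x) *\<^sub>R snd (\<phi> x) i) v"
      by (rule has_strong_integral_cong_AE[OF v[unfolded has_set_bochner_integral_iff]])
         (simp add: ind coord)
    moreover have "(\<integral>\<^sup>+ x. ennreal (norm (indicator A (\<phi> x) *\<^sub>R snd (\<phi> x) i)) \<partial>M) < \<infinity>"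
    proof -
      have "(\<integral>\<^sup>+ x. ennreal (norm (indicator A (\<phi> x) *\<^sub>R snd (\<phi> x) i)) \<partial>M) =
          (\<integral>\<^sup>+ x\<in>\<phi> -` A \<inter> space M. ennreal (norm (h i x)) \<partial>M)"
        by (intro nn_integral_cong) (simp add: coord indicator_def)
      also have "\<dots> < \<infinity>" using fin em[OF A] by (intro locally_integrable B) simp
      finally show ?thesis .
    qed
    ultimately show ?thesis
      unfolding has_set_bochner_integral_iff M'_def by (intro has_strong_integral_distr[OF \<phi> sm])
  qed
  have "martingale_on M' UNIV G' (\<lambda>i y. snd y i)"
    unfolding martingale_on_def
  proof (intro conjI ballI impI)
    show "filtration_on M' UNIV G'"
      unfolding filtration_on_def using sf filtration by (auto simp: G'_def sets_image_algebra)
    show "(\<lambda>y. snd y i) \<in> L1_loc M'" for i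
      unfolding L1_loc_def
    proof (intro CollectI conjI ballI impI smM')
      fix A assume A: "A \<in> sets M'" "emeasure M' A < \<infinity>"
      then have AN: "A \<in> sets N" by (simp add: sets_M')
      note [measurable] = AN strongly_measurable_norm[OF smN]
      have "(\<integral>\<^sup>+ y\<in>A. ennreal (norm (snd y i)) \<partial>M') = (\<integral>\<^sup>+ x. ennreal (norm (snd (\<phi> x) i)) * indicator A (\<phi> x) \<partial>M)"
        unfolding M'_def by (rule nn_integral_distr) measurable
      also have "\<dots> = (\<integral>\<^sup>+ x\<in>\<phi> -` A \<inter> space M. ennreal (norm (h i x)) \<partial>M)"
        by (intro nn_integral_cong) (simp add: coord indicator_def)
      also have "\<dots> < \<infinity>"
        using A em[OF A(1)] measurable_sets[OF \<phi> AN] by (intro locally_integrable) auto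
      finally show "(\<integral>\<^sup>+ y\<in>A. ennreal (norm (snd y i)) \<partial>M') < \<infinity>" .
    qed
    fix i j :: nat assume ij: "i \<le> j"
    show "is_cond_exp M' (G' i) (\<lambda>y. snd y j) (\<lambda>y. snd y i)"
      unfolding is_cond_exp_def
    proof (intro exI[of _ "\<lambda>y. snd y i"] conjI ballI impI smG')
      fix A assume A: "A \<in> sets (G' i)" "emeasure M' A < \<infinity>"
      then have AM': "A \<in> sets M'" using sets_sub by blast
      have "\<phi> -` A \<inter> space M \<in> sets (G i)" using A by (simp add: G'_def sets_image_algebra)
      then have "\<exists>v. has_set_bochner_integral M (\<phi> -` A \<inter> space M) (h i) v \<and>
          has_set_bochner_integral M (\<phi> -` A \<inter> space M) (h j) v"
        using A(2) em[OF AM'] by (intro same_integrals ij) simp_all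
      then show "\<exists>v. has_set_bochner_integral M' A (\<lambda>y. snd y j) v \<and>
          has_set_bochner_integral M' A (\<lambda>y. snd y i) v"
        using transfer[OF AM' A(2)] by blast
    qed simp
  qed
  then show thesis
    using \<phi> coord sigma_finite_subalgebra_is_sigma_finite[OF sf]
    unfolding M'_def N_def by (intro that) auto
qed

lemma jump_norm_le_by_path_space:
  assumes bound: "\<And>(N :: 'b path_space measure) I G (f :: nat \<Rightarrow> 'b path_space \<Rightarrow> 'b). sigma_finite_measure N \<Longrightarrow> finite I \<Longrightarrow>
      martingale_on N (I :: nat set) G f \<Longrightarrow>
      jump_norm p \<rho> N I f \<le> c * (SUP t\<in>I. Lp_norm p N (\<lambda>x. ennreal (norm (f t x))))"
  shows "jump_norm p \<rho> M {..n} h \<le> c * (SUP i\<in>{..n}. Lp_norm p M (\<lambda>x. ennreal (norm (h i x))))"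
proof -
  obtain \<phi> :: "'a \<Rightarrow> 'b path_space" and G' where
    \<phi> [measurable]: "\<phi> \<in> measurable M (image_algebra \<phi> M)" and coord: "\<And>i x. snd (\<phi> x) i = h i x"
    and sf: "sigma_finite_measure (distr M (image_algebra \<phi> M) \<phi>)"
    and mart: "martingale_on (distr M (image_algebra \<phi> M) \<phi>) UNIV G' (\<lambda>i y. snd y i)"
    using path_space_martingale by metis
  define M' where "M' = distr M (image_algebra \<phi> M) \<phi>"
  have Lp: "Lp_norm p M' u = Lp_norm p M (\<lambda>x. u (\<phi> x))"
    if "(\<lambda>x. u (\<phi> x)) \<in> borel_measurable M" for u
  proof -
    have [measurable]: "u \<in> borel_measurable (image_algebra \<phi> M)"
      by (rule measurable_from_image_algebra[where g=u and \<phi>=\<phi>, OF that])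
    show ?thesis unfolding Lp_norm_def M'_def by (subst nn_integral_distr) measurable
  qed
  have "martingale_on M' {..n} G' (\<lambda>i y. snd y i)"
    using mart by (simp add: M'_def martingale_on_def filtration_on_def)
  then have "jump_norm p \<rho> M' {..n} (\<lambda>i y. snd y i) \<le>
      c * (SUP i\<in>{..n}. Lp_norm p M' (\<lambda>y. ennreal (norm (snd y i))))"
    using sf unfolding M'_def by (intro bound) auto
  moreover have "jump_norm p \<rho> M' {..n} (\<lambda>i y. snd y i) = jump_norm p \<rho> M {..n} h"
  proof -
    note [measurable] = jump_count_measurable
    have "snd (\<phi> x) = (\<lambda>i. h i x)" for x using coord by auto
    then show ?thesis unfolding jump_norm_def by (subst Lp) simp_all
  qed
  moreover have "Lp_norm p M' (\<lambda>y. ennreal (norm (snd y i))) = Lp_norm p M (\<lambda>x. ennreal (norm (h i x)))" for i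
    by (subst Lp) (simp_all add: coord)
  ultimately show ?thesis by simp
qed

end

section \<open>The jump inequality\<close>

theorem theorem1p3:
  fixes p \<rho> :: real
  assumes "1 < p" and "2 \<le> \<rho>" and "martingale_cotype TYPE('b::banach) \<rho>"
  shows "\<forall>(M :: 'a measure) (I :: 'i::linorder set) (G :: 'i \<Rightarrow> 'a measure) (f :: 'i \<Rightarrow> 'a \<Rightarrow> 'b).
           sigma_finite_measure M \<longrightarrow> finite I \<longrightarrow> martingale_on M I G f \<longrightarrow>
           jump_norm p \<rho> M I f \<le>
             ennreal (jump_const p \<rho> TYPE('b)) *
             (SUP t\<in>I. Lp_norm p M (\<lambda>x. ennreal (norm (f t x))))"
proof -
  have p: "0 < p" "0 < \<rho>" using assms by auto
  obtain C where C: "\<And>(M :: 'b path_space measure) G (f :: nat \<Rightarrow> 'b path_space \<Rightarrow> 'b).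
      sigma_finite_measure M \<Longrightarrow> martingale_on M UNIV G f \<Longrightarrow>
      Lp_norm p M (S_rho \<rho> f) \<le> ennreal C * Lp_norm p M (maximal_fun f)"
    using assms(1,3) unfolding martingale_cotype_def by (meson less_imp_le)
  \<comment> \<open>The cotype constant \<open>C\<close> may be nonpositive.\<close>
  define K where "K = 2 * max C 1 * (2 * p / (p - 1))"
  have "jump_norm p \<rho> M I f \<le> ennreal K * (SUP t\<in>I. Lp_norm p M (\<lambda>x. ennreal (norm (f t x))))"
    if sf: "sigma_finite_measure M" and "finite I" and mart: "martingale_on M I G f"
    for M :: "'b path_space measure" and I :: "nat set" and G and f :: "nat \<Rightarrow> 'b path_space \<Rightarrow> 'b"
  proof (rule jump_norm_le_by_adapted[OF p \<open>finite I\<close> mart])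
    fix n G' and h :: "nat \<Rightarrow> 'b path_space \<Rightarrow> 'b"
    assume "adapted_martingale M G' h"
    then show "jump_norm p \<rho> M {..n} h \<le> ennreal K * (SUP i\<in>{..n}. Lp_norm p M (\<lambda>x. ennreal (norm (h i x))))"
      unfolding K_def
    proof (rule adapted_martingale.jump_inequality_if_cotype[OF _ assms(1) p(2)])
      fix G'' and f' :: "nat \<Rightarrow> 'b path_space \<Rightarrow> 'b"
      assume "martingale_on M UNIV G'' f'"
      then have "Lp_norm p M (S_rho \<rho> f') \<le> ennreal C * Lp_norm p M (maximal_fun f')" by (rule C[OF sf])
      also have "\<dots> \<le> ennreal (max C 1) * Lp_norm p M (maximal_fun f')"
        by (intro mult_right_mono ennreal_leI) auto
      finally show "Lp_norm p M (S_rho \<rho> f') \<le> ennreal (max C 1) * Lp_norm p M (maximal_fun f')" .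
    qed simp
  qed
  then have "\<exists>C. \<forall>(M :: 'b path_space measure) (I :: nat set) G (f :: nat \<Rightarrow> 'b path_space \<Rightarrow> 'b).
        sigma_finite_measure M \<longrightarrow> finite I \<longrightarrow> martingale_on M I G f \<longrightarrow>
        jump_norm p \<rho> M I f \<le>
          ennreal C * (SUP t\<in>I. Lp_norm p M (\<lambda>x. ennreal (norm (f t x))))" by blast
  \<comment> \<open>\<open>jump_const\<close> is a chosen constant of this kind, so it inherits the property.\<close>
  from someI_ex[OF this]
  have bound: "\<And>(M :: 'b path_space measure) (I :: nat set) G (f :: nat \<Rightarrow> 'b path_space \<Rightarrow> 'b).
        sigma_finite_measure M \<Longrightarrow> finite I \<Longrightarrow> martingale_on M I G f \<Longrightarrow>
        jump_norm p \<rho> M I f \<le>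
          ennreal (jump_const p \<rho> TYPE('b)) * (SUP t\<in>I. Lp_norm p M (\<lambda>x. ennreal (norm (f t x))))"
    unfolding jump_const_def by blast
  show ?thesis
  proof (intro allI impI)
    fix M :: "'a measure" and I :: "'i set" and G and f :: "'i \<Rightarrow> 'a \<Rightarrow> 'b"
    assume "finite I" and mart: "martingale_on M I G f"
    show "jump_norm p \<rho> M I f \<le> ennreal (jump_const p \<rho> TYPE('b)) *
        (SUP t\<in>I. Lp_norm p M (\<lambda>x. ennreal (norm (f t x))))"
    proof (rule jump_norm_le_by_adapted[OF p \<open>finite I\<close> mart])
      fix n G' and h :: "nat \<Rightarrow> 'a \<Rightarrow> 'b"
      assume "adapted_martingale M G' h"
      then show "jump_norm p \<rho> M {..n} h \<le> ennreal (jump_const p \<rho> TYPE('b)) *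
          (SUP i\<in>{..n}. Lp_norm p M (\<lambda>x. ennreal (norm (h i x))))"
        by (rule adapted_martingale.jump_norm_le_by_path_space) (rule bound)
    qed
  qed
qed

end
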